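(* Let $k\ge 2$ and $r\ge k$ be integers and let $H$ be a complete $k$-partite graph. Then $H$ is weakly $K_{r+1}$-Turán-stable. That is: for every $\varepsilon>0$ there exist $\delta>0$ and $n_0$ such that for every $n\ge n_0$, if $G$ is an $n$-vertex $K_{r+1}$-free graph with $\mathcal N(H,G)\ge \mathrm{ex}(n,H,K_{r+1})-\delta n^{h}$, where $h=|V(H)|$, then there is a complete $r$-partite graph $T$ on $n$ vertices whose edit distance from $G$ is at most $\varepsilon n^2$.
   Context: For graphs $H$ and $G$, $\mathcal N(H,G)$ denotes the number of subgraphs of $G$ isomorphic to $H$. For graphs $H,F$, $\mathrm{ex}(n,H,F)$ is the maximum of $\mathcal N(H,G)$ over all $n$-vertex graphs $G$ containing no subgraph isomorphic to $F$ ($F$-free). The edit distance of two $n$-vertex graphs $G$ and $G'$ is the minimum number of edges that must be deleted from and added to $G$ to obtain a graph isomorphic to $G'$. Given a graph $F$ with chromatic number $r+1$ and a graph $H$ with chromatic number at most $r$ and $h=|V(H)|$ vertices, $H$ is called weakly $F$-Turán-stable if for every $\varepsilon>0$ there exists $\delta>0$ such that (for all sufficiently large $n$) every $n$-vertex $F$-free graph $G$ with $\mathcal N(H,G)\ge \mathrm{ex}(n,H,F)-\delta n^h$ has edit distance at most $\varepsilon n^2$ from some complete $r$-partite $n$-vertex graph. *)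

theory Defs
  imports Complex_Main
begin

definition simple_graph :: "'a set \<Rightarrow> 'a set set \<Rightarrow> bool" where
  "simple_graph V E \<longleftrightarrow> finite V \<and> E \<subseteq> {{u, v} | u v. u \<in> V \<and> v \<in> V \<and> u \<noteq> v}"

definition graph_iso :: "'a set \<Rightarrow> 'a set set \<Rightarrow> 'b set \<Rightarrow> 'b set set \<Rightarrow> bool" where
  "graph_iso V1 E1 V2 E2 \<longleftrightarrow> (\<exists>f. bij_betw f V1 V2 \<and> E2 = (\<lambda>e. f ` e) ` E1)"

definition sub_count :: "'a set \<Rightarrow> 'a set set \<Rightarrow> 'b set \<Rightarrow> 'b set set \<Rightarrow> nat" where
  "sub_count VH EH V E =
     card {(V', E'). V' \<subseteq> V \<and> E' \<subseteq> E \<and> graph_iso VH EH V' E'}"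

definition free :: "'a set \<Rightarrow> 'a set set \<Rightarrow> 'b set \<Rightarrow> 'b set set \<Rightarrow> bool" where
  "free VF EF V E \<longleftrightarrow> sub_count VF EF V E = 0"

definition gen_ex :: "nat \<Rightarrow> 'a set \<Rightarrow> 'a set set \<Rightarrow> 'b set \<Rightarrow> 'b set set \<Rightarrow> nat" where
  "gen_ex n VH EH VF EF =
     Max {sub_count VH EH {0..<n} E | E. simple_graph {0..<n} E \<and> free VF EF {0..<n} E}"

definition complete_edges :: "nat \<Rightarrow> nat set set" where
  "complete_edges m = {{u, v} | u v. u < m \<and> v < m \<and> u \<noteq> v}"

definition complete_multipartite :: "nat \<Rightarrow> 'a set \<Rightarrow> 'a set set \<Rightarrow> bool" where
  "complete_multipartite k V E \<longleftrightarrow>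
     (\<exists>c :: 'a \<Rightarrow> nat. c ` V = {0..<k} \<and>
        E = {{u, v} | u v. u \<in> V \<and> v \<in> V \<and> c u \<noteq> c v})"

definition edit_dist :: "nat \<Rightarrow> nat set set \<Rightarrow> nat set set \<Rightarrow> nat" where
  "edit_dist n E1 E2 =
     Min {card ((E1 - (\<lambda>e. f ` e) ` E2) \<union> ((\<lambda>e. f ` e) ` E2 - E1)) | f.
            bij_betw f {0..<n} {0..<n}}"

end

theory Submission
  imports Defs "HOL-Library.FuncSet"
begin

text \<open>
  Up to lower order terms, counting copies of the complete \<open>k\<close>-partite graph \<open>H\<close> means counting
  homomorphisms. Zykov symmetrisation is applied in bulk: for a vertex \<open>x\<close>, every non-neighbour of
  \<open>x\<close> becomes a clone of \<open>x\<close> with a small probability \<open>t\<close>. Averaged over \<open>x\<close>, the number of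
  homomorphisms has no first order change in \<open>t\<close>, and its second order change is at least the
  number of pairs of a vertex \<open>x\<close> and a homomorphism sending two adjacent vertices of \<open>H\<close> to
  non-neighbours of \<open>x\<close>. Near the maximum this number is small. After deleting the edges that lie
  in few copies of \<open>H\<close>, few triples \<open>x, y, z\<close> remain with \<open>y\<close> adjacent to \<open>z\<close> but \<open>x\<close> to neither,
  so non-adjacency is almost an equivalence relation and the graph is close to a complete
  \<open>r\<close>-partite graph \<open>T\<close>. Since \<open>T\<close> is again nearly optimal, all its classes have linear size, and
  then many deleted edges inside the classes would create a clique on \<open>r + 1\<close> vertices.
\<close>

section \<open>Random subsets of a finite set\<close>

text \<open>Cloning with small probability instead of all at once makes the gain of order t^2 and
  the remainder of order t^3, so near-optimality bounds the gain without knowledge of any extremal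
  graph. The sign of the second-order term is where completeness of \<open>H\<close> enters: two
  vertices in one part have the same neighbours, so their contribution is a square. All maps are
  averaged, not only injective ones, because exchanging \<open>x\<close> with an image vertex can
  destroy injectivity. The resulting estimate weights a triple by the copies through its edge and is
  silent about edges in few copies. Deleting these costs optimality in proportion to the threshold,
  while a surviving edge is worth no more than that same threshold, so one threshold cannot serve
  both purposes; two far apart are used, and pigeonhole makes the edges between them rare. The
  deleted edges may still be numerous, and near-optimality does not see them: only the absence of
  large cliques controls them, once the classes of \<open>T\<close> are known to be large.\<close>

lemma sum_PiE_insert:
  assumes "u \<notin> W"
  shows "(\<Sum>\<phi>\<in>insert u W \<rightarrow>\<^sub>E V. F \<phi>) = (\<Sum>a\<in>V. \<Sum>\<psi>\<in>W \<rightarrow>\<^sub>E V. F (\<psi>(u := a)))"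
proof -
  have "(\<Sum>\<phi>\<in>insert u W \<rightarrow>\<^sub>E V. F \<phi>)
      = sum (F \<circ> (\<lambda>(y, g). g(u := y))) (V \<times> (W \<rightarrow>\<^sub>E V))"
    unfolding PiE_insert_eq by (rule sum.reindex[OF inj_combinator[OF assms]])
  then show ?thesis
    by (simp add: sum.cartesian_product split_def)
qed

lemma card_PiE_pair:
  fixes V :: "'b set"
  assumes "finite VH" "finite V" "u \<in> VH" "v \<in> VH" "u \<noteq> v"
  shows "card {\<phi> \<in> VH \<rightarrow>\<^sub>E V. P (\<phi> u) (\<phi> v)}
    = card {(a, b). a \<in> V \<and> b \<in> V \<and> P a b} * card V ^ (card VH - 2)"
proof -
  define W where "W = VH - {u, v}"
  have W: "VH = insert u (insert v W)" "u \<notin> insert v W" "v \<notin> W" "finite W"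
    using assms by (auto simp: W_def)
  have cW: "card W = card VH - 2"
    using assms by (simp add: W_def)
  have fin: "finite (VH \<rightarrow>\<^sub>E V)"
    using assms by (intro finite_PiE) auto
  have "card {\<phi> \<in> VH \<rightarrow>\<^sub>E V. P (\<phi> u) (\<phi> v)} = (\<Sum>\<phi>\<in>VH \<rightarrow>\<^sub>E V. of_bool (P (\<phi> u) (\<phi> v)))"
    using fin by (simp add: of_bool_def sum.If_cases Int_def conj_commute)
  also have "\<dots> = (\<Sum>a\<in>V. \<Sum>b\<in>V. of_bool (P a b) * card (W \<rightarrow>\<^sub>E V))"
    unfolding W(1) using W(2,3) by (auto simp: sum_PiE_insert mult.commute intro!: sum.cong)
  also have "\<dots> = (\<Sum>p\<in>V \<times> V. of_bool (P (fst p) (snd p))) * card (W \<rightarrow>\<^sub>E V)"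
    by (simp add: sum.cartesian_product sum_distrib_right split_def)
  also have "(\<Sum>p\<in>V \<times> V. of_bool (P (fst p) (snd p))) = card {(a, b). a \<in> V \<and> b \<in> V \<and> P a b}"
  proof -
    have "{(a, b). a \<in> V \<and> b \<in> V \<and> P a b} = V \<times> V \<inter> {p. P (fst p) (snd p)}" by auto
    then show ?thesis using assms by (simp add: of_bool_def sum.If_cases)
  qed
  also have "card (W \<rightarrow>\<^sub>E V) = card V ^ (card VH - 2)"
    using W(4) cW by (simp add: card_PiE)
  finally show ?thesis .
qed

lemma card_PiE_single:
  fixes V :: "'b set"
  assumes "finite VH" "finite V" "u \<in> VH"
  shows "card {\<phi> \<in> VH \<rightarrow>\<^sub>E V. P (\<phi> u)} = card {a \<in> V. P a} * card V ^ (card VH - 1)"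
proof -
  have "{\<phi> \<in> VH \<rightarrow>\<^sub>E V. P (\<phi> u)} = Pi\<^sub>E VH ((\<lambda>v. V)(u := {a \<in> V. P a}))"
    using assms(3) by (auto simp: PiE_iff extensional_def split: if_splits)
  then have "card {\<phi> \<in> VH \<rightarrow>\<^sub>E V. P (\<phi> u)} = (\<Prod>v\<in>VH. card (((\<lambda>v. V)(u := {a \<in> V. P a})) v))"
    using assms by (simp add: card_PiE)
  also have "\<dots> = card {a \<in> V. P a} * (\<Prod>v\<in>VH - {u}. card V)"
    using assms by (subst prod.remove[of _ u]) (auto intro!: prod.cong)
  finally show ?thesis using assms by simp
qed

lemma card_PiE_hits_set:
  fixes V :: "'b set"
  assumes "finite VH" "finite V" "S \<subseteq> V"
  shows "card {\<phi> \<in> VH \<rightarrow>\<^sub>E V. \<exists>u\<in>VH. \<phi> u \<in> S} \<le> card VH * (card S * card V ^ (card VH - 1))"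
proof -
  have "{\<phi> \<in> VH \<rightarrow>\<^sub>E V. \<exists>u\<in>VH. \<phi> u \<in> S} = (\<Union>u\<in>VH. {\<phi> \<in> VH \<rightarrow>\<^sub>E V. \<phi> u \<in> S})" by auto
  then have "card {\<phi> \<in> VH \<rightarrow>\<^sub>E V. \<exists>u\<in>VH. \<phi> u \<in> S} \<le> (\<Sum>u\<in>VH. card {\<phi> \<in> VH \<rightarrow>\<^sub>E V. \<phi> u \<in> S})"
    using card_UN_le[OF assms(1), of "\<lambda>u. {\<phi> \<in> VH \<rightarrow>\<^sub>E V. \<phi> u \<in> S}"] by simp
  also have "\<dots> \<le> (\<Sum>u\<in>VH. card S * card V ^ (card VH - 1))"
  proof (rule sum_mono)
    fix u assume "u \<in> VH"
    moreover have "{a \<in> V. a \<in> S} = S" using assms(3) by auto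
    ultimately show "card {\<phi> \<in> VH \<rightarrow>\<^sub>E V. \<phi> u \<in> S} \<le> card S * card V ^ (card VH - 1)"
      using card_PiE_single[of VH V u "\<lambda>a. a \<in> S"] assms by simp
  qed
  finally show ?thesis by simp
qed

lemma card_PiE_hits_pairs:
  fixes V :: "'b set"
  assumes "finite VH" "finite V"
  shows "card {\<phi> \<in> VH \<rightarrow>\<^sub>E V. \<exists>u\<in>VH. \<exists>v\<in>VH. u \<noteq> v \<and> P (\<phi> u) (\<phi> v)}
    \<le> (card VH)\<^sup>2 * (card {(a, b). a \<in> V \<and> b \<in> V \<and> P a b} * card V ^ (card VH - 2))"
proof -
  let ?I = "{(u, v). u \<in> VH \<and> v \<in> VH \<and> u \<noteq> v}"
  let ?F = "\<lambda>p. {\<phi> \<in> VH \<rightarrow>\<^sub>E V. P (\<phi> (fst p)) (\<phi> (snd p))}"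
  let ?c = "card {(a, b). a \<in> V \<and> b \<in> V \<and> P a b} * card V ^ (card VH - 2)"
  have I: "?I \<subseteq> VH \<times> VH" by auto
  then have finI: "finite ?I" using assms by (meson finite_SigmaI finite_subset)
  have "{\<phi> \<in> VH \<rightarrow>\<^sub>E V. \<exists>u\<in>VH. \<exists>v\<in>VH. u \<noteq> v \<and> P (\<phi> u) (\<phi> v)} = (\<Union>p\<in>?I. ?F p)" by fastforce
  then have "card {\<phi> \<in> VH \<rightarrow>\<^sub>E V. \<exists>u\<in>VH. \<exists>v\<in>VH. u \<noteq> v \<and> P (\<phi> u) (\<phi> v)} \<le> (\<Sum>p\<in>?I. card (?F p))"
    using card_UN_le[OF finI, of ?F] by simp
  also have "\<dots> = (\<Sum>p\<in>?I. ?c)"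
    using assms by (intro sum.cong) (auto simp: card_PiE_pair)
  also have "\<dots> \<le> card (VH \<times> VH) * ?c"
    using card_mono[OF _ I] assms by simp
  finally show ?thesis by (simp add: power2_eq_square card_cartesian_product)
qed

text \<open>Collisions cost a factor \<open>card V\<close>. This lower order term is the price both
  of averaging over all maps in the cloning argument and of passing from copies to
  homomorphisms.\<close>

lemma card_PiE_not_inj:
  fixes V :: "'b set"
  assumes "finite VH" "finite V" "2 \<le> card VH"
  shows "card {\<phi> \<in> VH \<rightarrow>\<^sub>E V. \<not> inj_on \<phi> VH} \<le> (card VH)\<^sup>2 * card V ^ (card VH - 1)"
proof -
  have "{(a, b). a \<in> V \<and> b \<in> V \<and> a = b} = (\<lambda>a. (a, a)) ` V" by auto
  then have "card {(a, b). a \<in> V \<and> b \<in> V \<and> a = b} = card V"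
    by (simp add: card_image inj_on_def)
  moreover have "{\<phi> \<in> VH \<rightarrow>\<^sub>E V. \<not> inj_on \<phi> VH}
      = {\<phi> \<in> VH \<rightarrow>\<^sub>E V. \<exists>u\<in>VH. \<exists>v\<in>VH. u \<noteq> v \<and> \<phi> u = \<phi> v}"
    by (auto simp: inj_on_def)
  moreover have "card VH - 1 = Suc (card VH - 2)" using assms by simp
  ultimately show ?thesis
    using card_PiE_hits_pairs[OF assms(1,2), of "(=)"] by simp
qed

text \<open>The expectation of \<open>Z\<close> over a random subset of \<open>H\<close> that
  contains each element independently with probability \<open>t\<close>, kept as an explicit
  polynomial in \<open>t\<close> so that conditioning on one element is a finite sum
  identity.\<close>

definition expect_subset :: "real \<Rightarrow> 'a set \<Rightarrow> ('a set \<Rightarrow> real) \<Rightarrow> real" where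
  "expect_subset t H Z = (\<Sum>S\<in>Pow H. t ^ card S * (1 - t) ^ card (H - S) * Z S)"

lemma expect_subset_empty [simp]: "expect_subset t {} Z = Z {}"
  by (simp add: expect_subset_def)

lemma expect_subset_insert:
  assumes "finite H" "v \<notin> H"
  shows "expect_subset t (insert v H) Z = (1 - t) * expect_subset t H Z + t * expect_subset t H (\<lambda>S. Z (insert v S))"
proof -
  let ?f = "\<lambda>S. t ^ card S * (1 - t) ^ card (insert v H - S) * Z S"
  have inj: "inj_on (insert v) (Pow H)"
    using assms(2) by (intro inj_onI) (metis PowD insert_ident subsetD)
  have "expect_subset t (insert v H) Z = sum ?f (Pow H) + sum ?f (insert v ` Pow H)"
    unfolding expect_subset_def Pow_insert using assms by (intro sum.union_disjoint) auto
  also have "sum ?f (Pow H) = (1 - t) * expect_subset t H Z"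
    unfolding expect_subset_def sum_distrib_left
  proof (rule sum.cong)
    fix S assume S: "S \<in> Pow H"
    then have "insert v H - S = insert v (H - S)" using assms by auto
    then have "card (insert v H - S) = Suc (card (H - S))" using assms by simp
    then show "?f S = (1 - t) * (t ^ card S * (1 - t) ^ card (H - S) * Z S)" by simp
  qed simp
  also have "sum ?f (insert v ` Pow H) = sum (?f \<circ> insert v) (Pow H)"
    by (rule sum.reindex[OF inj])
  also have "\<dots> = t * expect_subset t H (\<lambda>S. Z (insert v S))"
    unfolding expect_subset_def sum_distrib_left
  proof (rule sum.cong)
    fix S assume S: "S \<in> Pow H"
    then have "insert v H - insert v S = H - S" using assms by auto
    moreover have "card (insert v S) = Suc (card S)"
      using S assms by (intro card_insert_disjoint) (auto intro: finite_subset)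
    ultimately show "(?f \<circ> insert v) S = t * (t ^ card S * (1 - t) ^ card (H - S) * Z (insert v S))"
      by simp
  qed simp
  finally show ?thesis .
qed

text \<open>Points outside the image are integrated out one at a time, each contributing the factor
  (1 - t) + t = 1. On the image, subsets pull back bijectively to subsets of \<open>VH\<close>;
  injectivity is what makes the choices at different vertices of \<open>VH\<close>
  independent.\<close>

lemma expect_subset_marginal:
  assumes "finite VH" "finite D" "inj_on \<phi> VH" "\<phi> ` VH \<inter> D = {}"
  shows "expect_subset t (\<phi> ` VH \<union> D) (\<lambda>B. Z {v \<in> VH. \<phi> v \<in> B}) = expect_subset t VH Z"
  using assms(2,4)
proof (induction D)
  case empty
  have bij: "bij_betw ((`) \<phi>) (Pow VH) (Pow (\<phi> ` VH))"
    using assms(3) by (simp add: bij_betw_Pow inj_on_imp_bij_betw)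
  have "expect_subset t VH Z = (\<Sum>S\<in>Pow VH. t ^ card (\<phi> ` S) * (1 - t) ^ card (\<phi> ` VH - \<phi> ` S) * Z {v \<in> VH. \<phi> v \<in> \<phi> ` S})"
    unfolding expect_subset_def
  proof (rule sum.cong)
    fix S assume "S \<in> Pow VH"
    then have S: "S \<subseteq> VH" by simp
    have inj: "inj_on \<phi> S" "inj_on \<phi> (VH - S)"
      using S assms(3) by (auto intro: inj_on_subset)
    have "card (\<phi> ` S) = card S" using inj(1) by (rule card_image)
    moreover have "card (\<phi> ` VH - \<phi> ` S) = card (VH - S)"
      using inj_on_image_set_diff[OF assms(3) _ S, of VH] card_image[OF inj(2)] by simp
    moreover have "{v \<in> VH. \<phi> v \<in> \<phi> ` S} = S"
      using S inj_on_image_mem_iff[OF assms(3) _ S] by auto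
    ultimately show "t ^ card S * (1 - t) ^ card (VH - S) * Z S =
       t ^ card (\<phi> ` S) * (1 - t) ^ card (\<phi> ` VH - \<phi> ` S) * Z {v \<in> VH. \<phi> v \<in> \<phi> ` S}"
      by simp
  qed simp
  also have "\<dots> = expect_subset t (\<phi> ` VH) (\<lambda>B. Z {v \<in> VH. \<phi> v \<in> B})"
    unfolding expect_subset_def by (rule sum.reindex_bij_betw[OF bij])
  finally show ?case by simp
next
  case (insert d D)
  have eq: "{v \<in> VH. \<phi> v \<in> insert d B} = {v \<in> VH. \<phi> v \<in> B}" for B
    using insert.prems by auto
  have "expect_subset t (\<phi> ` VH \<union> insert d D) (\<lambda>B. Z {v \<in> VH. \<phi> v \<in> B})
      = expect_subset t (insert d (\<phi> ` VH \<union> D)) (\<lambda>B. Z {v \<in> VH. \<phi> v \<in> B})" by simp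
  also have "\<dots> = (1 - t) * expect_subset t (\<phi> ` VH \<union> D) (\<lambda>B. Z {v \<in> VH. \<phi> v \<in> B})
      + t * expect_subset t (\<phi> ` VH \<union> D) (\<lambda>B. Z {v \<in> VH. \<phi> v \<in> insert d B})"
    using insert assms(1) by (intro expect_subset_insert) auto
  also have "\<dots> = expect_subset t VH Z"
    unfolding eq using insert by (simp add: algebra_simps)
  finally show ?case .
qed

section \<open>Expansion of the expectation in powers of t\<close>

definition diff2 :: "('a set \<Rightarrow> real) \<Rightarrow> 'a \<Rightarrow> 'a \<Rightarrow> real" where
  "diff2 Z u v = (if u = v then 0 else Z {u, v} - Z {u} - Z {v} + Z {})"

text \<open>The terms of degree at most 2 of the expectation, a polynomial in \<open>t\<close> whose
  coefficients are sums of iterated differences of \<open>Z\<close> at the empty set. The double sum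
  runs over ordered pairs, so every pair counts twice and the factor is 1/2; \<open>diff2\<close>
  vanishes on the diagonal because an element is chosen only once.\<close>

definition taylor2 :: "real \<Rightarrow> 'a set \<Rightarrow> ('a set \<Rightarrow> real) \<Rightarrow> real" where
  "taylor2 t H Z = Z {} + t * (\<Sum>v\<in>H. Z {v} - Z {}) + t\<^sup>2 / 2 * (\<Sum>u\<in>H. \<Sum>v\<in>H. diff2 Z u v)"

lemma diff2_commute: "diff2 Z u v = diff2 Z v u"
  by (simp add: diff2_def insert_commute)

text \<open>The bracket is the difference of the two first-order expansions, with and without
  \<open>v\<close>. Thus the truncation obeys the recursion of \<open>expect_subset_insert\<close>,
  the factor \<open>t\<close> having used up one degree.\<close>

lemma taylor2_insert:
  assumes "finite H" "v \<notin> H"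
  shows "taylor2 t (insert v H) Z
    = taylor2 t H Z + t * ((Z {v} + t * (\<Sum>u\<in>H. Z {v, u} - Z {v})) - (Z {} + t * (\<Sum>u\<in>H. Z {u} - Z {})))"
proof -
  have d0: "diff2 Z v v = 0" by (simp add: diff2_def)
  have s: "(\<Sum>u\<in>H. diff2 Z u v) = (\<Sum>u\<in>H. diff2 Z v u)"
    by (rule sum.cong) (auto simp: diff2_commute)
  have "(\<Sum>u\<in>H. diff2 Z v u) = (\<Sum>u\<in>H. (Z {v, u} - Z {v}) - (Z {u} - Z {}))"
    using assms by (intro sum.cong) (auto simp: diff2_def)
  also have "\<dots> = (\<Sum>u\<in>H. Z {v, u} - Z {v}) - (\<Sum>u\<in>H. Z {u} - Z {})"
    by (rule sum_subtractf)
  finally have d1: "(\<Sum>u\<in>H. diff2 Z v u) = (\<Sum>u\<in>H. Z {v, u} - Z {v}) - (\<Sum>u\<in>H. Z {u} - Z {})" .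
  show ?thesis
    unfolding taylor2_def using assms
    by (simp add: sum.distrib d0 s d1) (simp add: field_simps power2_eq_square)
qed

lemma expect_subset_taylor0:
  assumes "finite H" "0 \<le> t" "t \<le> 1" "\<And>S. \<bar>Z S\<bar> \<le> 1"
  shows "\<bar>expect_subset t H Z\<bar> \<le> 1"
  using assms(1,4)
proof (induction H arbitrary: Z)
  case (insert v H)
  have "\<bar>expect_subset t H Z\<bar> \<le> 1" "\<bar>expect_subset t H (\<lambda>S. Z (insert v S))\<bar> \<le> 1"
    using insert.IH[of Z] insert.IH[of "\<lambda>S. Z (insert v S)"] insert.prems by auto
  then have "\<bar>(1 - t) * expect_subset t H Z\<bar> \<le> 1 - t" "\<bar>t * expect_subset t H (\<lambda>S. Z (insert v S))\<bar> \<le> t"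
    using assms(2,3) by (simp_all add: abs_mult mult_left_le)
  then show ?case using insert by (simp add: expect_subset_insert)
qed simp

text \<open>Splitting off \<open>v\<close> adds \<open>t\<close> times the difference of two
  expectations over \<open>H\<close>, so an error bound of one order needs only the bound of the
  order below. The next two orders repeat the argument, and their constants close because 2 h^j + 4
  h^(j-1) \<le> 2 (h + 1)^j.\<close>

lemma expect_subset_taylor1:
  assumes "finite H" "0 \<le> t" "t \<le> 1" "\<And>S. \<bar>Z S\<bar> \<le> 1"
  shows "\<bar>expect_subset t H Z - Z {}\<bar> \<le> 2 * real (card H) * t"
  using assms(1,4)
proof (induction H arbitrary: Z)
  case (insert v H)
  let ?Z = "\<lambda>S. Z (insert v S)"
  have "\<bar>expect_subset t H Z\<bar> \<le> 1" "\<bar>expect_subset t H ?Z\<bar> \<le> 1"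
    using expect_subset_taylor0[of H t Z] expect_subset_taylor0[of H t ?Z] insert.hyps insert.prems assms(2,3) by auto
  then have "t * \<bar>expect_subset t H ?Z - expect_subset t H Z\<bar> \<le> t * 2"
    using assms(2) by (intro mult_left_mono) auto
  then have a: "\<bar>t * (expect_subset t H ?Z - expect_subset t H Z)\<bar> \<le> 2 * t"
    using assms(2) by (simp add: abs_mult)
  have b: "\<bar>expect_subset t H Z - Z {}\<bar> \<le> 2 * real (card H) * t" using insert by simp
  have "expect_subset t (insert v H) Z - Z {} = (expect_subset t H Z - Z {}) + t * (expect_subset t H ?Z - expect_subset t H Z)"
    using insert by (simp add: expect_subset_insert algebra_simps)
  also have "\<bar>\<dots>\<bar> \<le> 2 * real (card H) * t + 2 * t" using a b by linarith
  finally show ?case using insert by (simp add: algebra_simps)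
qed simp

lemma expect_subset_taylor2:
  assumes "finite H" "0 \<le> t" "t \<le> 1" "\<And>S. \<bar>Z S\<bar> \<le> 1"
  shows "\<bar>expect_subset t H Z - (Z {} + t * (\<Sum>v\<in>H. Z {v} - Z {}))\<bar> \<le> 2 * real (card H) ^ 2 * t\<^sup>2"
  using assms(1,4)
proof (induction H arbitrary: Z)
  case (insert v H)
  let ?Z = "\<lambda>S. Z (insert v S)"
  let ?h = "real (card H)"
  have "\<bar>expect_subset t H Z - Z {}\<bar> \<le> 2 * ?h * t" "\<bar>expect_subset t H ?Z - Z {v}\<bar> \<le> 2 * ?h * t"
    using expect_subset_taylor1[of H t Z] expect_subset_taylor1[of H t ?Z] insert.hyps insert.prems assms(2,3) by auto
  then have "t * \<bar>(expect_subset t H ?Z - Z {v}) - (expect_subset t H Z - Z {})\<bar> \<le> t * (4 * ?h * t)"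
    using assms(2) by (intro mult_left_mono) auto
  then have a: "\<bar>t * ((expect_subset t H ?Z - Z {v}) - (expect_subset t H Z - Z {}))\<bar> \<le> 4 * ?h * t\<^sup>2"
    using assms(2) by (simp add: abs_mult power2_eq_square mult_ac)
  have b: "\<bar>expect_subset t H Z - (Z {} + t * (\<Sum>v\<in>H. Z {v} - Z {}))\<bar> \<le> 2 * ?h ^ 2 * t\<^sup>2"
    using insert by simp
  have "expect_subset t (insert v H) Z - (Z {} + t * (\<Sum>v\<in>insert v H. Z {v} - Z {}))
      = (expect_subset t H Z - (Z {} + t * (\<Sum>v\<in>H. Z {v} - Z {})))
        + t * ((expect_subset t H ?Z - Z {v}) - (expect_subset t H Z - Z {}))"
    using insert by (simp add: expect_subset_insert algebra_simps)
  also have "\<bar>\<dots>\<bar> \<le> 2 * ?h ^ 2 * t\<^sup>2 + 4 * ?h * t\<^sup>2" using a b by linarith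
  also have "\<dots> \<le> 2 * (?h + 1) ^ 2 * t\<^sup>2"
    by (simp add: power2_eq_square algebra_simps)
  finally show ?case using insert by (simp add: add.commute)
qed simp

text \<open>A cubic error is what the application needs: there the constant term is known, the
  linear one averages to zero, and the gain is quadratic in \<open>t\<close>.\<close>

lemma expect_subset_taylor3:
  assumes "finite H" "0 \<le> t" "t \<le> 1" "\<And>S. \<bar>Z S\<bar> \<le> 1"
  shows "\<bar>expect_subset t H Z - taylor2 t H Z\<bar> \<le> 2 * real (card H) ^ 3 * t ^ 3"
  using assms(1,4)
proof (induction H arbitrary: Z)
  case empty
  then show ?case by (simp add: taylor2_def)
next
  case (insert v H)
  let ?Z = "\<lambda>S. Z (insert v S)"
  let ?h = "real (card H)"
  let ?l = "Z {} + t * (\<Sum>u\<in>H. Z {u} - Z {})"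
  let ?m = "Z {v} + t * (\<Sum>u\<in>H. Z {v, u} - Z {v})"
  have "\<bar>expect_subset t H Z - ?l\<bar> \<le> 2 * ?h ^ 2 * t\<^sup>2" "\<bar>expect_subset t H ?Z - ?m\<bar> \<le> 2 * ?h ^ 2 * t\<^sup>2"
    using expect_subset_taylor2[of H t Z] expect_subset_taylor2[of H t ?Z] insert.hyps insert.prems assms(2,3) by auto
  then have "t * \<bar>(expect_subset t H ?Z - ?m) - (expect_subset t H Z - ?l)\<bar> \<le> t * (4 * ?h ^ 2 * t\<^sup>2)"
    using assms(2) by (intro mult_left_mono) auto
  then have a: "\<bar>t * ((expect_subset t H ?Z - ?m) - (expect_subset t H Z - ?l))\<bar> \<le> 4 * ?h ^ 2 * t ^ 3"
    using assms(2) by (simp add: abs_mult power2_eq_square power3_eq_cube mult_ac)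
  have b: "\<bar>expect_subset t H Z - taylor2 t H Z\<bar> \<le> 2 * ?h ^ 3 * t ^ 3"
    using insert by simp
  have "expect_subset t (insert v H) Z - taylor2 t (insert v H) Z
      = (expect_subset t H Z - taylor2 t H Z) + t * ((expect_subset t H ?Z - ?m) - (expect_subset t H Z - ?l))"
    using insert by (simp add: expect_subset_insert taylor2_insert) (simp add: algebra_simps)
  also have "\<bar>\<dots>\<bar> \<le> 2 * ?h ^ 3 * t ^ 3 + 4 * ?h ^ 2 * t ^ 3" using a b by linarith
  also have "\<dots> = (2 * ?h ^ 3 + 4 * ?h ^ 2) * t ^ 3" by (simp add: algebra_simps)
  also have "\<dots> \<le> (2 * (?h + 1) ^ 3) * t ^ 3"
    using assms(2) by (intro mult_right_mono) (auto simp: power2_eq_square power3_eq_cube algebra_simps)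
  finally show ?case using insert by (simp add: add.commute)
qed

section \<open>Symmetrisation\<close>

definition rel_graph :: "('b \<Rightarrow> 'b \<Rightarrow> bool) \<Rightarrow> bool" where
  "rel_graph A \<longleftrightarrow> (\<forall>x y. A x y \<longrightarrow> A y x) \<and> (\<forall>x. \<not> A x x)"

definition clique_free :: "nat \<Rightarrow> 'b set \<Rightarrow> ('b \<Rightarrow> 'b \<Rightarrow> bool) \<Rightarrow> bool" where
  "clique_free r V A \<longleftrightarrow> (\<forall>K\<subseteq>V. (\<forall>x\<in>K. \<forall>y\<in>K. x \<noteq> y \<longrightarrow> A x y) \<longrightarrow> card K \<le> r)"

definition clone :: "('b \<Rightarrow> 'b \<Rightarrow> bool) \<Rightarrow> 'b \<Rightarrow> 'b set \<Rightarrow> 'b \<Rightarrow> 'b" where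
  "clone A x B y = (if y \<in> B \<and> \<not> A y x then x else y)"

text \<open>The pull-back of \<open>A\<close> along the map collapsing the chosen non-neighbours of
  \<open>x\<close> onto \<open>x\<close>. In a graph, a cloned vertex thereby gets exactly the
  neighbours of \<open>x\<close>: these are never moved, and all other vertices, moved or not, end
  up non-adjacent to \<open>x\<close>.\<close>

definition clone_adj :: "('b \<Rightarrow> 'b \<Rightarrow> bool) \<Rightarrow> 'b \<Rightarrow> 'b set \<Rightarrow> 'b \<Rightarrow> 'b \<Rightarrow> bool" where
  "clone_adj A x B y z = A (clone A x B y) (clone A x B z)"

lemma rel_graph_clone_adj: "rel_graph A \<Longrightarrow> rel_graph (clone_adj A x B)"
  by (simp add: rel_graph_def clone_adj_def)

text \<open>Adjacent vertices of the new graph have adjacent, hence distinct, images under the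
  collapse, so a clique is mapped injectively onto a clique of \<open>A\<close>.\<close>

lemma clique_free_clone_adj:
  assumes "rel_graph A" "clique_free r V A" "x \<in> V"
  shows "clique_free r V (clone_adj A x B)"
  unfolding clique_free_def
proof (intro allI impI)
  fix K assume K: "K \<subseteq> V" "\<forall>y\<in>K. \<forall>z\<in>K. y \<noteq> z \<longrightarrow> clone_adj A x B y z"
  let ?f = "clone A x B"
  have inj: "inj_on ?f K"
    using K(2) assms(1) by (metis clone_adj_def inj_onI rel_graph_def)
  have "?f ` K \<subseteq> V" using K(1) assms(3) by (auto simp: clone_def)
  moreover have "\<forall>y\<in>?f ` K. \<forall>z\<in>?f ` K. y \<noteq> z \<longrightarrow> A y z"
    using K(2) by (auto simp: clone_adj_def)
  ultimately have "card (?f ` K) \<le> r" using assms(2) by (simp add: clique_free_def)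
  then show "card K \<le> r" using inj by (simp add: card_image)
qed

section \<open>Homomorphisms of a complete multipartite graph and their behaviour under
  cloning\<close>

locale multipartite_pattern =
  fixes VH :: "'a set" and cH :: "'a \<Rightarrow> nat" and k :: nat
  assumes finVH: "finite VH" and parts: "cH ` VH = {0..<k}" and k2: "2 \<le> k"
begin

definition ishom :: "('b \<Rightarrow> 'b \<Rightarrow> bool) \<Rightarrow> ('a \<Rightarrow> 'b) \<Rightarrow> bool" where
  "ishom A \<phi> \<longleftrightarrow> (\<forall>u\<in>VH. \<forall>v\<in>VH. cH u \<noteq> cH v \<longrightarrow> A (\<phi> u) (\<phi> v))"

definition homs :: "'b set \<Rightarrow> ('b \<Rightarrow> 'b \<Rightarrow> bool) \<Rightarrow> ('a \<Rightarrow> 'b) set" where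
  "homs V A = {\<phi> \<in> VH \<rightarrow>\<^sub>E V. ishom A \<phi>}"

text \<open>The slack \<open>d\<close> is an absolute number of homomorphisms, not a density; it is
  later taken as a multiple of n^h.\<close>

definition near_opt :: "nat \<Rightarrow> 'b set \<Rightarrow> ('b \<Rightarrow> 'b \<Rightarrow> bool) \<Rightarrow> real \<Rightarrow> bool" where
  "near_opt r V A d \<longleftrightarrow> rel_graph A \<and> clique_free r V A \<and>
     (\<forall>A'. rel_graph A' \<and> clique_free r V A' \<longrightarrow> real (card (homs V A')) \<le> real (card (homs V A)) + d)"

text \<open>The collapse applied after \<open>\<phi>\<close>, with the choice made at vertices of
  \<open>H\<close> instead of at their images. The two agree when \<open>S\<close> is the preimage
  of the chosen set; this version also treats non-injective \<open>\<phi>\<close> vertex by vertex,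
  as the exchange argument over all maps requires.\<close>

definition shift :: "('b \<Rightarrow> 'b \<Rightarrow> bool) \<Rightarrow> 'b \<Rightarrow> ('a \<Rightarrow> 'b) \<Rightarrow> 'a set \<Rightarrow> 'a \<Rightarrow> 'b" where
  "shift A x \<phi> S v = (if v \<in> S \<and> \<not> A (\<phi> v) x then x else \<phi> v)"

definition hom_shift :: "('b \<Rightarrow> 'b \<Rightarrow> bool) \<Rightarrow> 'b \<Rightarrow> ('a \<Rightarrow> 'b) \<Rightarrow> 'a set \<Rightarrow> real" where
  "hom_shift A x \<phi> S = of_bool (ishom A (shift A x \<phi> S))"

definition bad_sum :: "'b set \<Rightarrow> ('b \<Rightarrow> 'b \<Rightarrow> bool) \<Rightarrow> real" where
  "bad_sum V A = (\<Sum>x\<in>V. \<Sum>\<phi>\<in>VH \<rightarrow>\<^sub>E V. \<Sum>u\<in>VH. \<Sum>v\<in>VH.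
     of_bool (cH u \<noteq> cH v \<and> ishom A \<phi> \<and> \<not> A (\<phi> u) x \<and> \<not> A (\<phi> v) x))"

lemma card_VH_ge: "k \<le> card VH"
  using card_image_le[OF finVH, of cH] parts by simp

lemma card_VH_ge2: "2 \<le> card VH"
  using card_VH_ge k2 by simp

lemma finite_maps: "finite V \<Longrightarrow> finite (VH \<rightarrow>\<^sub>E V)"
  using finVH by (intro finite_PiE) auto

lemma card_maps: "finite V \<Longrightarrow> card (VH \<rightarrow>\<^sub>E V) = card V ^ card VH"
  using finVH by (simp add: card_PiE)

lemma finite_homs: "finite V \<Longrightarrow> finite (homs V A)"
  using finite_maps[of V] by (simp add: homs_def)

lemma card_homs_eq: "finite V \<Longrightarrow> real (card (homs V A)) = (\<Sum>\<phi>\<in>VH \<rightarrow>\<^sub>E V. of_bool (ishom A \<phi>))"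
  using finite_maps[of V] by (simp add: homs_def of_bool_def sum.If_cases Int_def)

lemma ishom_clone_adj:
  "ishom (clone_adj A x B) \<phi> \<longleftrightarrow> ishom A (shift A x \<phi> {v \<in> VH. \<phi> v \<in> B})"
  by (simp add: ishom_def clone_adj_def clone_def shift_def)

lemma ishom_cong: "(\<And>v. v \<in> VH \<Longrightarrow> \<phi> v = \<psi> v) \<Longrightarrow> ishom A \<phi> = ishom A \<psi>"
  by (simp add: ishom_def)

lemma hom_shift_empty: "hom_shift A x \<phi> {} = of_bool (ishom A \<phi>)"
  using ishom_cong[of "shift A x \<phi> {}" \<phi> A] by (simp add: hom_shift_def shift_def)

lemma abs_hom_shift_le: "\<bar>hom_shift A x \<phi> S\<bar> \<le> 1"
  by (simp add: hom_shift_def)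

text \<open>Exchanging \<open>x\<close> with \<open>\<phi> v\<close> is an involution that negates the summand.\<close>

lemma first_order_sum:
  assumes "rel_graph A" "finite V" "v \<in> VH"
  shows "(\<Sum>x\<in>V. \<Sum>\<phi>\<in>VH \<rightarrow>\<^sub>E V. hom_shift A x \<phi> {v} - hom_shift A x \<phi> {}) = 0"
proof -
  let ?g = "\<lambda>(x, \<phi>). hom_shift A x \<phi> {v} - hom_shift A x \<phi> {}"
  let ?f = "\<lambda>(x, \<phi>). of_bool (\<not> A (\<phi> v) x) * (of_bool (ishom A (\<phi>(v := x))) - of_bool (ishom A \<phi>)) :: real"
  let ?s = "\<lambda>(x, \<phi>). (\<phi> v, \<phi>(v := x))"
  let ?D = "V \<times> (VH \<rightarrow>\<^sub>E V)"
  have g: "?g p = ?f p" for p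
  proof -
    obtain x \<phi> where p: "p = (x, \<phi>)" by (cases p)
    have "shift A x \<phi> {v} = (if A (\<phi> v) x then \<phi> else \<phi>(v := x))"
      by (auto simp: shift_def fun_eq_iff)
    then show ?thesis by (simp add: p hom_shift_empty) (simp add: hom_shift_def)
  qed
  have "sum ?f ?D = sum (\<lambda>p. - ?f p) ?D"
  proof (rule sum.reindex_bij_witness[where i = ?s and j = ?s])
    fix p assume "p \<in> ?D"
    then obtain x \<phi> where p: "p = (x, \<phi>)" "x \<in> V" "\<phi> \<in> VH \<rightarrow>\<^sub>E V" by auto
    show "?s (?s p) = p" by (simp add: p)
    show "?s p \<in> ?D" using p assms(3) by (auto simp: PiE_iff extensional_def)
    show "- ?f (?s p) = ?f p"
      using assms(1) by (auto simp: p rel_graph_def)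
  qed (use assms in \<open>auto simp: PiE_iff extensional_def\<close>)
  then have "sum ?f ?D = 0" by (simp add: sum_negf)
  then have "sum ?g ?D = 0" using g by (simp cong: sum.cong)
  then show ?thesis by (simp add: sum.cartesian_product)
qed

text \<open>In different parts: if one image is adjacent to \<open>x\<close>, shifting it changes
  nothing and the mixed difference vanishes; otherwise every nonempty shift puts \<open>x\<close>
  opposite a non-neighbour or opposite itself, and only the unshifted term survives. In the same
  part: \<open>u\<close> and \<open>v\<close> are non-adjacent with equal neighbourhoods in
  \<open>H\<close>, so once the rest of the map is fixed the two shifts act independently and in the
  same way, and the sum is a square.\<close>

lemma second_order_sum:
  assumes "rel_graph A" "finite V" "u \<in> VH" "v \<in> VH"
  shows "(\<Sum>\<phi>\<in>VH \<rightarrow>\<^sub>E V. of_bool (cH u \<noteq> cH v \<and> ishom A \<phi> \<and> \<not> A (\<phi> u) x \<and> \<not> A (\<phi> v) x))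
    \<le> (\<Sum>\<phi>\<in>VH \<rightarrow>\<^sub>E V. diff2 (hom_shift A x \<phi>) u v)"
proof (cases "cH u = cH v")
  case False
  then have uv: "u \<noteq> v" by auto
  show ?thesis
  proof (rule sum_mono)
    fix \<phi>
    have *: "\<not> ishom A \<psi>" if "\<psi> u = a" "\<psi> v = b" "\<not> A a b" for \<psi> a b
      using that False assms(3,4) by (auto simp: ishom_def)
    have sym: "\<not> A x b" if "\<not> A b x" for b using that assms(1) by (auto simp: rel_graph_def)
    have irr: "\<not> A x x" using assms(1) by (auto simp: rel_graph_def)
    show "of_bool (cH u \<noteq> cH v \<and> ishom A \<phi> \<and> \<not> A (\<phi> u) x \<and> \<not> A (\<phi> v) x)
        \<le> diff2 (hom_shift A x \<phi>) u v"
    proof (cases "A (\<phi> u) x \<or> A (\<phi> v) x")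
      case True
      then have "shift A x \<phi> {u, v} = shift A x \<phi> {u} \<and> shift A x \<phi> {v} = shift A x \<phi> {}
        \<or> shift A x \<phi> {u, v} = shift A x \<phi> {v} \<and> shift A x \<phi> {u} = shift A x \<phi> {}"
        by (auto simp: shift_def fun_eq_iff)
      then have "diff2 (hom_shift A x \<phi>) u v = 0" by (auto simp: diff2_def hom_shift_def)
      then show ?thesis using True by auto
    next
      case F: False
      have "hom_shift A x \<phi> {u, v} = 0" "hom_shift A x \<phi> {u} = 0" "hom_shift A x \<phi> {v} = 0"
        using *[of "shift A x \<phi> {u, v}" x x] *[of "shift A x \<phi> {u}" x "\<phi> v"]
          *[of "shift A x \<phi> {v}" "\<phi> u" x] F uv sym irr
        by (auto simp: hom_shift_def shift_def)
      then show ?thesis using uv by (simp add: diff2_def hom_shift_empty)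
    qed
  qed
next
  case same: True
  have "0 \<le> (\<Sum>\<phi>\<in>VH \<rightarrow>\<^sub>E V. diff2 (hom_shift A x \<phi>) u v)"
  proof (cases "u = v")
    case True
    then show ?thesis by (simp add: diff2_def)
  next
    case uv: False
    define W where "W = VH - {u, v}"
    have W: "VH = insert u (insert v W)" "u \<notin> insert v W" "v \<notin> W" "finite W"
      using assms uv finVH by (auto simp: W_def)
    \<comment> \<open>\<open>C\<close> says that the rest of the map is a homomorphism,
      \<open>f\<close> that \<open>a\<close> may be the image of \<open>u\<close>, equivalently of
      \<open>v\<close>; both vertices see the same \<open>f\<close> because they lie in one part of
      \<open>H\<close>.\<close>
    define C where "C \<psi> = (of_bool (\<forall>p\<in>W. \<forall>q\<in>W. cH p \<noteq> cH q \<longrightarrow> A (\<psi> p) (\<psi> q)) :: real)" for \<psi>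
    define f where "f \<psi> a = (of_bool (\<forall>q\<in>W. cH q \<noteq> cH u \<longrightarrow> A a (\<psi> q)) :: real)" for \<psi> a
    have sym: "A a b = A b a" for a b using assms(1) by (auto simp: rel_graph_def)
    have VHW: "(\<forall>p\<in>VH. P p) \<longleftrightarrow> P u \<and> P v \<and> (\<forall>p\<in>W. P p)" for P
      using W(1) by blast
    have fac: "of_bool (ishom A \<theta>) = C \<psi> * (f \<psi> (\<theta> u) * f \<psi> (\<theta> v))"
      if "\<And>w. w \<in> W \<Longrightarrow> \<theta> w = \<psi> w" for \<theta> \<psi>
    proof -
      have "ishom A \<theta> \<longleftrightarrow> (\<forall>p\<in>W. \<forall>q\<in>W. cH p \<noteq> cH q \<longrightarrow> A (\<psi> p) (\<psi> q)) \<and>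
          (\<forall>q\<in>W. cH q \<noteq> cH u \<longrightarrow> A (\<theta> u) (\<psi> q)) \<and> (\<forall>q\<in>W. cH q \<noteq> cH u \<longrightarrow> A (\<theta> v) (\<psi> q))"
        unfolding ishom_def VHW using that same sym by auto
      then show ?thesis by (simp add: C_def f_def of_bool_conj)
    qed
    \<comment> \<open>The change of \<open>f\<close> when \<open>a\<close> is replaced by
      \<open>x\<close>; the mixed difference is a product of two such changes.\<close>
    define e where "e \<psi> a = of_bool (\<not> A a x) * (f \<psi> x - f \<psi> a)" for \<psi> a
    have "diff2 (hom_shift A x (\<psi>(v := b, u := a))) u v = C \<psi> * (e \<psi> a * e \<psi> b)" for \<psi> a b
    proof -
      let ?\<phi> = "\<psi>(v := b, u := a)"
      have off: "w \<in> W \<Longrightarrow> w \<notin> S \<Longrightarrow> shift A x ?\<phi> S w = \<psi> w" for S w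
        using W by (auto simp: shift_def)
      define a' where "a' = (if A a x then a else x)"
      define b' where "b' = (if A b x then b else x)"
      have "hom_shift A x ?\<phi> {u, v} = C \<psi> * (f \<psi> a' * f \<psi> b')"
        "hom_shift A x ?\<phi> {u} = C \<psi> * (f \<psi> a' * f \<psi> b)"
        "hom_shift A x ?\<phi> {v} = C \<psi> * (f \<psi> a * f \<psi> b')"
        "hom_shift A x ?\<phi> {} = C \<psi> * (f \<psi> a * f \<psi> b)"
        unfolding hom_shift_def
        by (subst fac[of _ \<psi>], rule off, simp, use W in blast,
            use uv in \<open>simp add: shift_def a'_def b'_def\<close>)+
      moreover have "e \<psi> a = f \<psi> a' - f \<psi> a" "e \<psi> b = f \<psi> b' - f \<psi> b"
        by (auto simp: e_def a'_def b'_def)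
      ultimately show ?thesis using uv by (simp add: diff2_def) (simp add: algebra_simps)
    qed
    then have "(\<Sum>\<phi>\<in>VH \<rightarrow>\<^sub>E V. diff2 (hom_shift A x \<phi>) u v)
        = (\<Sum>a\<in>V. \<Sum>b\<in>V. \<Sum>\<psi>\<in>W \<rightarrow>\<^sub>E V. C \<psi> * (e \<psi> a * e \<psi> b))"
      unfolding W(1) by (simp add: sum_PiE_insert[OF W(2)] sum_PiE_insert[OF W(3)])
    also have "\<dots> = (\<Sum>\<psi>\<in>W \<rightarrow>\<^sub>E V. \<Sum>a\<in>V. \<Sum>b\<in>V. C \<psi> * (e \<psi> a * e \<psi> b))"
      by (subst (2) sum.swap, subst sum.swap) simp
    also have "\<dots> = (\<Sum>\<psi>\<in>W \<rightarrow>\<^sub>E V. C \<psi> * (\<Sum>a\<in>V. e \<psi> a)\<^sup>2)"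
      unfolding power2_eq_square sum_product unfolding sum_distrib_left ..
    also have "\<dots> \<ge> 0"
      by (intro sum_nonneg mult_nonneg_nonneg) (auto simp: C_def)
    finally show ?thesis .
  qed
  then show ?thesis using same by simp
qed

lemma taylor2_hom_shift_sum:
  assumes "rel_graph A" "finite V"
  shows "(\<Sum>x\<in>V. \<Sum>\<phi>\<in>VH \<rightarrow>\<^sub>E V. taylor2 t VH (hom_shift A x \<phi>))
    \<ge> real (card V) * real (card (homs V A)) + t\<^sup>2 / 2 * bad_sum V A"
proof -
  let ?M = "VH \<rightarrow>\<^sub>E V"
  have "(\<Sum>x\<in>V. \<Sum>\<phi>\<in>?M. \<Sum>v\<in>VH. hom_shift A x \<phi> {v} - hom_shift A x \<phi> {})
      = (\<Sum>v\<in>VH. \<Sum>x\<in>V. \<Sum>\<phi>\<in>?M. hom_shift A x \<phi> {v} - hom_shift A x \<phi> {})"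
    by (subst (2) sum.swap, subst sum.swap) simp
  also have "\<dots> = 0" using assms by (simp add: first_order_sum)
  finally have 1: "(\<Sum>x\<in>V. \<Sum>\<phi>\<in>?M. \<Sum>v\<in>VH. hom_shift A x \<phi> {v} - hom_shift A x \<phi> {}) = 0" .
  have swap: "(\<Sum>\<phi>\<in>?M. \<Sum>u\<in>VH. \<Sum>v\<in>VH. F \<phi> u v) = (\<Sum>u\<in>VH. \<Sum>v\<in>VH. \<Sum>\<phi>\<in>?M. F \<phi> u v)"
    for F :: "_ \<Rightarrow> _ \<Rightarrow> _ \<Rightarrow> real"
    by (subst sum.swap, rule sum.cong, simp, rule sum.swap)
  have 2: "bad_sum V A \<le> (\<Sum>x\<in>V. \<Sum>\<phi>\<in>?M. \<Sum>u\<in>VH. \<Sum>v\<in>VH. diff2 (hom_shift A x \<phi>) u v)"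
    unfolding bad_sum_def swap using assms by (intro sum_mono second_order_sum)
  have "(\<Sum>x\<in>V. \<Sum>\<phi>\<in>?M. taylor2 t VH (hom_shift A x \<phi>))
    = (\<Sum>x\<in>V. \<Sum>\<phi>\<in>?M. of_bool (ishom A \<phi>))
      + t * (\<Sum>x\<in>V. \<Sum>\<phi>\<in>?M. \<Sum>v\<in>VH. hom_shift A x \<phi> {v} - hom_shift A x \<phi> {})
      + t\<^sup>2 / 2 * (\<Sum>x\<in>V. \<Sum>\<phi>\<in>?M. \<Sum>u\<in>VH. \<Sum>v\<in>VH. diff2 (hom_shift A x \<phi>) u v)"
    unfolding taylor2_def hom_shift_empty sum_distrib_left sum.distrib ..
  also have "(\<Sum>x\<in>V. \<Sum>\<phi>\<in>?M. of_bool (ishom A \<phi>)) = real (card V) * real (card (homs V A))"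
    using assms by (simp add: card_homs_eq)
  finally show ?thesis using 1 mult_left_mono[OF 2, of "t\<^sup>2 / 2"] by simp
qed

text \<open>For each \<open>x\<close> every outcome of the random cloning is a competitor, so the
  expected count exceeds the present one by at most \<open>d\<close>. Summing over \<open>x\<close>
  leaves the quadratic gain against three losses: the slack, the cubic Taylor remainder and the
  non-injective maps.\<close>

lemma bad_sum_le:
  assumes opt: "near_opt r V A d" and fin: "finite V" and t: "0 \<le> t" "t \<le> 1"
  defines "n \<equiv> real (card V)" and "h \<equiv> real (card VH)"
  shows "t\<^sup>2 / 2 * bad_sum V A
    \<le> n * d + 2 * h ^ 3 * t ^ 3 * n ^ (card VH + 1) + (1 + 2 * h ^ 3) * h\<^sup>2 * n ^ card VH"
proof -
  let ?M = "VH \<rightarrow>\<^sub>E V"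
  let ?N = "{\<phi> \<in> ?M. \<not> inj_on \<phi> VH}"
  let ?T = "\<lambda>x \<phi>. taylor2 t VH (hom_shift A x \<phi>)"
  let ?hom = "real (card (homs V A))"
  have graph: "rel_graph A" "clique_free r V A"
    using opt by (auto simp: near_opt_def)
  have finM: "finite ?M" using finite_maps[OF fin] .
  have tay: "\<bar>expect_subset t VH (hom_shift A x \<phi>) - ?T x \<phi>\<bar> \<le> 2 * h ^ 3 * t ^ 3"
    "\<bar>expect_subset t VH (hom_shift A x \<phi>)\<bar> \<le> 1" for x \<phi>
    using expect_subset_taylor3[OF finVH t abs_hom_shift_le] expect_subset_taylor0[OF finVH t abs_hom_shift_le]
    by (auto simp: h_def)
  have "2 * h ^ 3 * t ^ 3 \<le> 2 * h ^ 3"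
    using t by (simp add: h_def mult_left_le power_le_one)
  then have T_le: "?T x \<phi> \<le> 1 + 2 * h ^ 3" for x \<phi>
    using tay[of x \<phi>] by linarith
  have w_one: "expect_subset t V (\<lambda>_. y) = y" for y
    using fin by (induction V) (auto simp: expect_subset_insert algebra_simps)
  have per_x: "(\<Sum>\<phi>\<in>?M. ?T x \<phi>) - 2 * h ^ 3 * t ^ 3 * n ^ card VH
      - (1 + 2 * h ^ 3) * (h\<^sup>2 * n ^ (card VH - 1)) \<le> ?hom + d"
    if x: "x \<in> V" for x
  proof -
    have "expect_subset t V (\<lambda>B. \<Sum>\<phi>\<in>?M. of_bool (ishom (clone_adj A x B) \<phi>)) \<le> expect_subset t V (\<lambda>_. ?hom + d)"
      unfolding expect_subset_def
    proof (rule sum_mono)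
      fix B
      have "(\<Sum>\<phi>\<in>?M. of_bool (ishom (clone_adj A x B) \<phi>)) \<le> ?hom + d"
        using opt rel_graph_clone_adj[OF graph(1)] clique_free_clone_adj[OF graph x]
          card_homs_eq[OF fin] by (metis near_opt_def)
      then show "t ^ card B * (1 - t) ^ card (V - B) * (\<Sum>\<phi>\<in>?M. of_bool (ishom (clone_adj A x B) \<phi>))
          \<le> t ^ card B * (1 - t) ^ card (V - B) * (?hom + d)"
        using t by (intro mult_left_mono) auto
    qed
    then have top: "expect_subset t V (\<lambda>B. \<Sum>\<phi>\<in>?M. of_bool (ishom (clone_adj A x B) \<phi>)) \<le> ?hom + d"
      using w_one by simp
    \<comment> \<open>The cancellation of the linear term needs all maps, while the link with random
      cloning is made only for injective ones. The Taylor polynomials of the remaining maps are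
      therefore bounded trivially and removed.\<close>
    have "(\<Sum>\<phi>\<in>?N. ?T x \<phi>) \<le> real (card ?N) * (1 + 2 * h ^ 3)"
      using T_le by (intro sum_bounded_above) auto
    moreover have "card (?M - ?N) \<le> card V ^ card VH"
      using card_mono[OF finM, of "?M - ?N"] card_maps[OF fin] by auto
    then have "real (card (?M - ?N)) \<le> n ^ card VH"
      by (metis n_def of_nat_le_iff of_nat_power)
    then have "real (card (?M - ?N)) * (2 * h ^ 3 * t ^ 3) \<le> n ^ card VH * (2 * h ^ 3 * t ^ 3)"
      using t by (intro mult_right_mono) (auto simp: h_def)
    ultimately have "(\<Sum>\<phi>\<in>?M. ?T x \<phi>) - real (card ?N) * (1 + 2 * h ^ 3) - n ^ card VH * (2 * h ^ 3 * t ^ 3)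
      \<le> (\<Sum>\<phi>\<in>?M. ?T x \<phi>) - (\<Sum>\<phi>\<in>?N. ?T x \<phi>) - real (card (?M - ?N)) * (2 * h ^ 3 * t ^ 3)"
      by linarith
    also have "\<dots> = (\<Sum>\<phi>\<in>?M - ?N. ?T x \<phi> - 2 * h ^ 3 * t ^ 3)"
    proof -
      have "(\<Sum>\<phi>\<in>?M - ?N. ?T x \<phi>) = (\<Sum>\<phi>\<in>?M. ?T x \<phi>) - (\<Sum>\<phi>\<in>?N. ?T x \<phi>)"
        using finM by (intro sum_diff) auto
      then show ?thesis by (simp add: sum_subtractf)
    qed
    also have "\<dots> \<le> (\<Sum>\<phi>\<in>?M - ?N. expect_subset t VH (hom_shift A x \<phi>))"
    proof (rule sum_mono)
      fix \<phi> show "?T x \<phi> - 2 * h ^ 3 * t ^ 3 \<le> expect_subset t VH (hom_shift A x \<phi>)"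
        using tay(1)[of x \<phi>] by linarith
    qed
    also have "\<dots> = (\<Sum>\<phi>\<in>?M - ?N. expect_subset t V (\<lambda>B. of_bool (ishom (clone_adj A x B) \<phi>)))"
    proof (rule sum.cong)
      fix \<phi> assume "\<phi> \<in> ?M - ?N"
      then have \<phi>: "inj_on \<phi> VH" "\<phi> ` VH \<subseteq> V" by auto
      then have "\<phi> ` VH \<union> (V - \<phi> ` VH) = V" by auto
      then show "expect_subset t VH (hom_shift A x \<phi>) = expect_subset t V (\<lambda>B. of_bool (ishom (clone_adj A x B) \<phi>))"
        using expect_subset_marginal[OF finVH _ \<phi>(1), of "V - \<phi> ` VH" t "hom_shift A x \<phi>"] fin
        by (simp add: ishom_clone_adj hom_shift_def)
    qed simp
    also have "\<dots> \<le> (\<Sum>\<phi>\<in>?M. expect_subset t V (\<lambda>B. of_bool (ishom (clone_adj A x B) \<phi>)))"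
      using finM t by (intro sum_mono2) (auto simp: expect_subset_def intro!: sum_nonneg mult_nonneg_nonneg)
    also have "\<dots> = expect_subset t V (\<lambda>B. \<Sum>\<phi>\<in>?M. of_bool (ishom (clone_adj A x B) \<phi>))"
      unfolding expect_subset_def sum_distrib_left by (rule sum.swap)
    also note top
    finally have "(\<Sum>\<phi>\<in>?M. ?T x \<phi>) - real (card ?N) * (1 + 2 * h ^ 3) - n ^ card VH * (2 * h ^ 3 * t ^ 3)
      \<le> ?hom + d" .
    moreover have "real (card ?N) * (1 + 2 * h ^ 3) \<le> (h\<^sup>2 * n ^ (card VH - 1)) * (1 + 2 * h ^ 3)"
    proof (rule mult_right_mono)
      have "real (card ?N) \<le> real ((card VH)\<^sup>2 * card V ^ (card VH - 1))"
        using card_PiE_not_inj[OF finVH fin card_VH_ge2] by (simp only: of_nat_le_iff)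
      then show "real (card ?N) \<le> h\<^sup>2 * n ^ (card VH - 1)" by (simp add: h_def n_def)
    qed (simp add: h_def)
    ultimately show ?thesis by (simp add: mult_ac)
  qed
  have "n * ?hom + t\<^sup>2 / 2 * bad_sum V A \<le> (\<Sum>x\<in>V. \<Sum>\<phi>\<in>?M. ?T x \<phi>)"
    using taylor2_hom_shift_sum[OF graph(1) fin] by (simp add: n_def)
  also have "\<dots> \<le> (\<Sum>x\<in>V. ?hom + d + 2 * h ^ 3 * t ^ 3 * n ^ card VH
      + (1 + 2 * h ^ 3) * (h\<^sup>2 * n ^ (card VH - 1)))"
    using per_x by (intro sum_mono) (simp add: algebra_simps)
  also have "\<dots> = n * ?hom + n * d + 2 * h ^ 3 * t ^ 3 * n ^ (card VH + 1)
      + (1 + 2 * h ^ 3) * h\<^sup>2 * (n * n ^ (card VH - 1))"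
    by (simp add: n_def algebra_simps)
  also have "n * n ^ (card VH - 1) = n ^ card VH"
    using card_VH_ge2 by (metis Suc_diff_1 less_le_trans pos2 power_Suc)
  finally show ?thesis by simp
qed

end

section \<open>Bad triples and light edges\<close>

definition bad_triples :: "'b set \<Rightarrow> ('b \<Rightarrow> 'b \<Rightarrow> bool) \<Rightarrow> ('b \<times> 'b \<times> 'b) set" where
  "bad_triples V A = {(x, y, z). x \<in> V \<and> y \<in> V \<and> z \<in> V \<and> \<not> A y x \<and> \<not> A z x \<and> A y z}"

text \<open>The ordered pairs on which \<open>A\<close> disagrees with the complete multipartite
  graph whose classes are the colour classes of \<open>c\<close>; diagonal pairs are never errors of
  an irreflexive \<open>A\<close>.\<close>

definition colour_errors :: "'b set \<Rightarrow> ('b \<Rightarrow> 'b \<Rightarrow> bool) \<Rightarrow> ('b \<Rightarrow> nat) \<Rightarrow> ('b \<times> 'b) set" where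
  "colour_errors U A c = {(y, z). y \<in> U \<and> z \<in> U \<and> (A y z \<longleftrightarrow> c y = c z)}"

lemma finite_colour_errors: "finite V \<Longrightarrow> finite (colour_errors V A c)"
  by (rule finite_subset[of _ "V \<times> V"]) (auto simp: colour_errors_def)

lemma clique_free_mono:
  assumes "clique_free r V A" "\<And>x y. A' x y \<Longrightarrow> A x y"
  shows "clique_free r V A'"
  unfolding clique_free_def
proof (intro allI impI)
  fix K assume "K \<subseteq> V" "\<forall>x\<in>K. \<forall>y\<in>K. x \<noteq> y \<longrightarrow> A' x y"
  then show "card K \<le> r" using assms by (simp add: clique_free_def)
qed

lemma card_Collect_pairs:
  "finite V \<Longrightarrow> real (card {(a, b). a \<in> V \<and> b \<in> V \<and> P a b}) = (\<Sum>p\<in>V \<times> V. of_bool (P (fst p) (snd p)))"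
proof -
  assume "finite V"
  moreover have "{(a, b). a \<in> V \<and> b \<in> V \<and> P a b} = V \<times> V \<inter> {p. P (fst p) (snd p)}" by auto
  ultimately show ?thesis by (simp add: of_bool_def sum.If_cases)
qed

lemma card_fibres_triples:
  assumes "finite V" "T \<subseteq> V \<times> V \<times> V"
  shows "(\<Sum>x\<in>V. card {(y, z). (x, y, z) \<in> T}) = card T"
    and "(\<Sum>x\<in>V. card {(y, z). (y, x, z) \<in> T}) = card T"
proof -
  have fT: "finite T" using assms by (meson finite_SigmaI finite_subset)
  have 1: "card {(y, z). (x, y, z) \<in> T} = card {p \<in> T. fst p = x}" for x
    by (rule bij_betw_same_card[of "\<lambda>(y, z). (x, y, z)"])
      (auto simp: bij_betw_def inj_on_def image_def)
  have 2: "card {(y, z). (y, x, z) \<in> T} = card {p \<in> T. fst (snd p) = x}" for x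
    by (rule bij_betw_same_card[of "\<lambda>(y, z). (y, x, z)"])
      (auto simp: bij_betw_def inj_on_def image_def)
  have "(\<Sum>x\<in>V. \<Sum>p\<in>{p \<in> T. fst p = x}. 1) = (\<Sum>p\<in>T. 1::nat)"
    using assms by (intro sum.group fT) auto
  then show "(\<Sum>x\<in>V. card {(y, z). (x, y, z) \<in> T}) = card T" by (simp add: 1)
  have "(\<Sum>x\<in>V. \<Sum>p\<in>{p \<in> T. fst (snd p) = x}. 1) = (\<Sum>p\<in>T. 1::nat)"
    using assms by (intro sum.group fT) auto
  then show "(\<Sum>x\<in>V. card {(y, z). (y, x, z) \<in> T}) = card T" by (simp add: 2)
qed

text \<open>The pivots chosen in the recursion are pairwise adjacent, so there are at most \<open>r\<close> of them.\<close>

lemma colouring_of_few_bad_triples: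
  fixes V :: "'b set"
  assumes graph: "rel_graph A" and fin: "finite V" and \<gamma>: "0 < \<gamma>"
  defines "n \<equiv> real (card V)"
  assumes bad: "real (card (bad_triples V A)) \<le> \<beta> * n ^ 3" and \<beta>: "0 \<le> \<beta>"
    and "U \<subseteq> V" "clique_free s U A"
  shows "\<exists>c. (\<forall>y\<in>U. c y < s) \<and>
    real (card (colour_errors U A c)) \<le> real s * (3 * \<beta> / \<gamma> * n\<^sup>2) + \<gamma> * n\<^sup>2"
  using assms(7,8)
proof (induction s arbitrary: U)
  case 0
  have "U = {}"
  proof (rule ccontr)
    assume "U \<noteq> {}"
    then obtain x where "x \<in> U" by auto
    then have "card {x} \<le> 0" using 0 unfolding clique_free_def by blast
    then show False by simp
  qed
  then show ?case using \<gamma> by (simp add: colour_errors_def)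
next
  case (Suc s)
  have finU: "finite U" using Suc.prems fin finite_subset by blast
  have sym: "A a b = A b a" for a b using graph by (auto simp: rel_graph_def)
  have irr: "\<not> A a a" for a using graph by (auto simp: rel_graph_def)
  have cU: "real (card U) \<le> n" using Suc.prems fin by (simp add: n_def card_mono)
  show ?case
  proof (cases "real (card U) < \<gamma> * n")
    case True
    \<comment> \<open>A remainder of fewer than \<open>\<gamma> * n\<close> vertices gets a single
      colour. This ends the recursion, so its cost enters the final bound only once.\<close>
    have "card (colour_errors U A (\<lambda>_. 0)) \<le> card (U \<times> U)"
      using finU by (intro card_mono) (auto simp: colour_errors_def)
    then have "real (card (colour_errors U A (\<lambda>_. 0))) \<le> real (card U) * real (card U)"
      by (metis card_cartesian_product of_nat_le_iff of_nat_mult)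
    also have "\<dots> \<le> (\<gamma> * n) * n" using True cU by (intro mult_mono) auto
    also have "\<dots> \<le> real (Suc s) * (3 * \<beta> / \<gamma> * n\<^sup>2) + \<gamma> * n\<^sup>2"
      using \<beta> \<gamma> by (simp add: power2_eq_square)
    finally show ?thesis by (intro exI[of _ "\<lambda>_. 0"]) auto
  next
    case False
    let ?p = "\<lambda>x. card {(y, z). (x, y, z) \<in> bad_triples V A}"
    let ?q = "\<lambda>x. card {(y, z). (y, x, z) \<in> bad_triples V A}"
    show ?thesis
    proof (cases "U = {}")
      case True
      then show ?thesis using \<gamma> \<beta> by (simp add: colour_errors_def)
    next
      case ne: False
      have n0: "n > 0" using ne Suc.prems fin by (auto simp: n_def card_gt_0_iff)
      \<comment> \<open>Over all of \<open>V\<close> the weights add up to three times the number of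
        bad triples, and \<open>U\<close> has at least \<open>\<gamma> * n\<close> vertices, so some
        pivot is no worse than average. \<open>?p\<close> counts edges among the non-neighbours of
        the pivot, \<open>?q\<close> missing edges between a non-neighbour and a neighbour; the
        latter get weight 2 because errors are ordered pairs.\<close>
      have "\<exists>x\<in>U. real (?p x + 2 * ?q x) \<le> 3 * \<beta> / \<gamma> * n\<^sup>2"
      proof (rule ccontr)
        assume "\<not> ?thesis"
        then have "(\<Sum>x\<in>U. 3 * \<beta> / \<gamma> * n\<^sup>2) < (\<Sum>x\<in>U. real (?p x + 2 * ?q x))"
          using finU ne by (intro sum_strict_mono) auto
        also have "\<dots> \<le> (\<Sum>x\<in>V. real (?p x + 2 * ?q x))"
          using fin Suc.prems by (intro sum_mono2) auto
        also have "\<dots> = 3 * real (card (bad_triples V A))"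
        proof -
          have T: "bad_triples V A \<subseteq> V \<times> V \<times> V" by (auto simp: bad_triples_def)
          have "(\<Sum>x\<in>V. ?p x + 2 * ?q x) = 3 * card (bad_triples V A)"
            using card_fibres_triples[OF fin T] by (simp add: sum.distrib flip: sum_distrib_left)
          then have "real (\<Sum>x\<in>V. ?p x + 2 * ?q x) = 3 * real (card (bad_triples V A))" by simp
          then show ?thesis unfolding of_nat_sum .
        qed
        also have "\<dots> \<le> 3 * (\<beta> * n ^ 3)" using bad by simp
        finally have "real (card U) * (3 * \<beta> / \<gamma> * n\<^sup>2) < 3 * (\<beta> * n ^ 3)" by simp
        moreover have "3 * (\<beta> * n ^ 3) = (\<gamma> * n) * (3 * \<beta> / \<gamma> * n\<^sup>2)"
          using \<gamma> by (simp add: power2_eq_square power3_eq_cube)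
        moreover have "(\<gamma> * n) * (3 * \<beta> / \<gamma> * n\<^sup>2) \<le> real (card U) * (3 * \<beta> / \<gamma> * n\<^sup>2)"
          using False \<beta> \<gamma> by (intro mult_right_mono) auto
        ultimately show False by linarith
      qed
      then obtain x where x: "x \<in> U" "real (?p x + 2 * ?q x) \<le> 3 * \<beta> / \<gamma> * n\<^sup>2" by blast
      let ?U = "{y \<in> U. A y x}"
      have "clique_free s ?U A"
        unfolding clique_free_def
      proof (intro allI impI)
        fix K assume K: "K \<subseteq> ?U" "\<forall>x\<in>K. \<forall>y\<in>K. x \<noteq> y \<longrightarrow> A x y"
        have "insert x K \<subseteq> U" "\<forall>y\<in>insert x K. \<forall>z\<in>insert x K. y \<noteq> z \<longrightarrow> A y z"
          using K x sym by auto
        then have "card (insert x K) \<le> Suc s" using Suc.prems by (auto simp: clique_free_def)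
        moreover have "x \<notin> K" "finite K" using K irr finU by (auto intro: finite_subset)
        ultimately show "card K \<le> s" by simp
      qed
      then obtain c' where c': "\<forall>y\<in>?U. c' y < s"
        "real (card (colour_errors ?U A c')) \<le> real s * (3 * \<beta> / \<gamma> * n\<^sup>2) + \<gamma> * n\<^sup>2"
        using Suc.IH[of ?U] Suc.prems by auto
      \<comment> \<open>The non-neighbours of the pivot, itself included, form one class. Its colour
        \<open>s\<close> is fresh, since the neighbours are coloured below \<open>s\<close>.\<close>
      define c where "c y = (if A y x then c' y else s)" for y
      let ?P = "{(y, z). (x, y, z) \<in> bad_triples V A}"
      let ?Q = "{(y, z). (y, x, z) \<in> bad_triples V A}"
      have finPQ: "finite ?P" "finite ?Q"
        by (rule finite_subset[of _ "V \<times> V"]; use fin in \<open>auto simp: bad_triples_def\<close>)+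
      have sub: "colour_errors U A c \<subseteq> colour_errors ?U A c' \<union> (?P \<union> (?Q \<union> prod.swap ` ?Q))"
      proof
        fix p assume "p \<in> colour_errors U A c"
        then obtain y z where p: "p = (y, z)" "y \<in> U" "z \<in> U" "A y z \<longleftrightarrow> c y = c z"
          by (auto simp: colour_errors_def)
        have V: "x \<in> V" "y \<in> V" "z \<in> V" using p x Suc.prems by auto
        consider "A y x" "A z x" | "\<not> A y x" "\<not> A z x" | "\<not> A y x" "A z x" | "A y x" "\<not> A z x"
          by blast
        then show "p \<in> colour_errors ?U A c' \<union> (?P \<union> (?Q \<union> prod.swap ` ?Q))"
        proof cases
          case 1
          then show ?thesis using p by (auto simp: colour_errors_def c_def)
        next
          case 2
          then have "p \<in> ?P" using p V by (auto simp: bad_triples_def c_def)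
          then show ?thesis by blast
        next
          case 3
          then have "c z < s" "c y = s" using c'(1) p by (auto simp: c_def)
          then have "p \<in> ?Q" using 3 p V sym by (auto simp: bad_triples_def)
          then show ?thesis by blast
        next
          case 4
          then have "c y < s" "c z = s" using c'(1) p by (auto simp: c_def)
          then have "(z, y) \<in> ?Q" using 4 p V sym by (auto simp: bad_triples_def)
          then show ?thesis using p(1) by (auto simp: image_iff)
        qed
      qed
      have "card (colour_errors U A c) \<le> card (colour_errors ?U A c' \<union> (?P \<union> (?Q \<union> prod.swap ` ?Q)))"
        using finPQ finU by (intro card_mono sub) (auto intro: finite_colour_errors)
      also have "\<dots> \<le> card (colour_errors ?U A c') + (card ?P + (card ?Q + card (prod.swap ` ?Q)))"
        using card_Un_le[of "colour_errors ?U A c'" "?P \<union> (?Q \<union> prod.swap ` ?Q)"]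
          card_Un_le[of ?P "?Q \<union> prod.swap ` ?Q"] card_Un_le[of ?Q "prod.swap ` ?Q"] by linarith
      also have "card (prod.swap ` ?Q) = card ?Q" by (intro card_image) auto
      finally have "real (card (colour_errors U A c)) \<le> real (card (colour_errors ?U A c')) + real (?p x + 2 * ?q x)"
        by linarith
      also have "\<dots> \<le> real (Suc s) * (3 * \<beta> / \<gamma> * n\<^sup>2) + \<gamma> * n\<^sup>2"
        using c'(2) x(2) unfolding of_nat_Suc distrib_right by linarith
      finally have "real (card (colour_errors U A c)) \<le> real (Suc s) * (3 * \<beta> / \<gamma> * n\<^sup>2) + \<gamma> * n\<^sup>2" .
      moreover have "\<forall>y\<in>U. c y < Suc s" using c'(1) by (auto simp: c_def less_Suc_eq)
      ultimately show ?thesis by blast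
    qed
  qed
qed

section \<open>Edges weighted by the copies through them\<close>

context multipartite_pattern
begin

definition flags :: "'b set \<Rightarrow> ('b \<Rightarrow> 'b \<Rightarrow> bool) \<Rightarrow> (('a \<Rightarrow> 'b) \<times> 'a \<times> 'a) set" where
  "flags V A = {(\<phi>, u, v). \<phi> \<in> homs V A \<and> u \<in> VH \<and> v \<in> VH \<and> cH u \<noteq> cH v}"

text \<open>Homomorphisms through an ordered pair, counted once for every ordered edge of
  \<open>H\<close> landing on it. The number is at most of order n^(h - 2), which is the scale of
  the thresholds below.\<close>

definition codeg :: "'b set \<Rightarrow> ('b \<Rightarrow> 'b \<Rightarrow> bool) \<Rightarrow> 'b \<Rightarrow> 'b \<Rightarrow> real" where
  "codeg V A a b = real (card {(\<phi>, u, v) \<in> flags V A. \<phi> u = a \<and> \<phi> v = b})"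

text \<open>Copies are counted in \<open>A\<close>, not in the graph that remains, so all light
  edges go at once and a surviving edge may itself lose copies.\<close>

definition heavy :: "'b set \<Rightarrow> ('b \<Rightarrow> 'b \<Rightarrow> bool) \<Rightarrow> real \<Rightarrow> 'b \<Rightarrow> 'b \<Rightarrow> bool" where
  "heavy V A s a b \<longleftrightarrow> A a b \<and> s \<le> codeg V A a b"

definition medium :: "'b set \<Rightarrow> ('b \<Rightarrow> 'b \<Rightarrow> bool) \<Rightarrow> real \<Rightarrow> real \<Rightarrow> ('b \<times> 'b) set" where
  "medium V A s' s = {(a, b). a \<in> V \<and> b \<in> V \<and> A a b \<and> s' \<le> codeg V A a b \<and> codeg V A a b < s}"

lemma flags_subset: "flags V A \<subseteq> homs V A \<times> VH \<times> VH"
  by (auto simp: flags_def)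

lemma finite_flags: "finite V \<Longrightarrow> finite (flags V A)"
  by (rule finite_subset[OF flags_subset]) (simp add: finite_homs finVH)

lemma codeg_commute: "codeg V A a b = codeg V A b a"
  unfolding codeg_def of_nat_eq_iff
  by (rule bij_betw_same_card[of "\<lambda>(\<phi>, u, v). (\<phi>, v, u)"])
    (rule bij_betw_byWitness[where f' = "\<lambda>(\<phi>, u, v). (\<phi>, v, u)"]; force simp: flags_def)

lemma rel_graph_heavy: "rel_graph A \<Longrightarrow> rel_graph (heavy V A s)"
  unfolding rel_graph_def heavy_def by (metis codeg_commute)

lemma homs_mono:
  assumes "\<And>x y. A' x y \<Longrightarrow> A x y"
  shows "homs V A' \<subseteq> homs V A"
  using assms by (auto simp: homs_def ishom_def)

lemma sum_flags:
  assumes "finite V"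
  shows "(\<Sum>(\<phi>, u, v)\<in>flags V A. g (\<phi> u) (\<phi> v)) = (\<Sum>p\<in>V \<times> V. g (fst p) (snd p) * codeg V A (fst p) (snd p))"
proof -
  let ?e = "\<lambda>(\<phi>, u, v). (\<phi> u, \<phi> v)"
  have img: "?e ` flags V A \<subseteq> V \<times> V"
    by (auto simp: flags_def homs_def)
  have "(\<Sum>(\<phi>, u, v)\<in>flags V A. g (\<phi> u) (\<phi> v))
      = (\<Sum>p\<in>V \<times> V. \<Sum>q\<in>{q \<in> flags V A. ?e q = p}. case q of (\<phi>, u, v) \<Rightarrow> g (\<phi> u) (\<phi> v))"
    using assms img by (intro sum.group[symmetric]) (auto simp: finite_flags)
  also have "\<dots> = (\<Sum>p\<in>V \<times> V. g (fst p) (snd p) * codeg V A (fst p) (snd p))"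
  proof (rule sum.cong)
    fix p
    have eq: "{q \<in> flags V A. ?e q = p} = {(\<phi>, u, v) \<in> flags V A. \<phi> u = fst p \<and> \<phi> v = snd p}"
      by (cases p) auto
    have "(\<Sum>q\<in>{q \<in> flags V A. ?e q = p}. case q of (\<phi>, u, v) \<Rightarrow> g (\<phi> u) (\<phi> v))
        = (\<Sum>q\<in>{q \<in> flags V A. ?e q = p}. g (fst p) (snd p))"
      by (rule sum.cong) auto
    also have "\<dots> = real (card {q \<in> flags V A. ?e q = p}) * g (fst p) (snd p)" by simp
    finally show "(\<Sum>q\<in>{q \<in> flags V A. ?e q = p}. case q of (\<phi>, u, v) \<Rightarrow> g (\<phi> u) (\<phi> v))
        = g (fst p) (snd p) * codeg V A (fst p) (snd p)"
      unfolding codeg_def eq[symmetric] by simp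
  qed simp
  finally show ?thesis .
qed

lemma bad_sum_flags:
  assumes "finite V"
  shows "bad_sum V A = (\<Sum>x\<in>V. \<Sum>(\<phi>, u, v)\<in>flags V A. of_bool (\<not> A (\<phi> u) x \<and> \<not> A (\<phi> v) x))"
  unfolding bad_sum_def
proof (rule sum.cong)
  fix x
  let ?M = "VH \<rightarrow>\<^sub>E V"
  let ?f = "\<lambda>(\<phi>, u, v). of_bool (cH u \<noteq> cH v \<and> ishom A \<phi> \<and> \<not> A (\<phi> u) x \<and> \<not> A (\<phi> v) x) :: real"
  have "(\<Sum>\<phi>\<in>?M. \<Sum>u\<in>VH. \<Sum>v\<in>VH. ?f (\<phi>, u, v)) = sum ?f (?M \<times> VH \<times> VH)"
    by (simp add: sum.cartesian_product split_def)
  also have "\<dots> = (\<Sum>(\<phi>, u, v)\<in>flags V A. of_bool (\<not> A (\<phi> u) x \<and> \<not> A (\<phi> v) x))"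
    using finite_maps[OF assms] finVH
    by (intro sum.mono_neutral_cong_right) (auto simp: flags_def homs_def)
  finally show "(\<Sum>\<phi>\<in>?M. \<Sum>u\<in>VH. \<Sum>v\<in>VH.
      of_bool (cH u \<noteq> cH v \<and> ishom A \<phi> \<and> \<not> A (\<phi> u) x \<and> \<not> A (\<phi> v) x))
      = (\<Sum>(\<phi>, u, v)\<in>flags V A. of_bool (\<not> A (\<phi> u) x \<and> \<not> A (\<phi> v) x) :: real)" by simp
qed simp

text \<open>A lost homomorphism has a flag on a light pair; there are at most \<open>card V\<close>
  squared pairs, and a light one carries fewer than \<open>s\<close> flags.\<close>

lemma card_homs_heavy:
  assumes "finite V" "0 \<le> s"
  shows "real (card (homs V A - homs V (heavy V A s))) \<le> s * real (card V) ^ 2"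
proof -
  let ?D = "homs V A - homs V (heavy V A s)"
  let ?L = "{(\<phi>, u, v) \<in> flags V A. codeg V A (\<phi> u) (\<phi> v) < s}"
  have img: "?D \<subseteq> fst ` ?L"
  proof
    fix \<phi> assume "\<phi> \<in> ?D"
    then obtain u v where "\<phi> \<in> homs V A" "u \<in> VH" "v \<in> VH" "cH u \<noteq> cH v" "codeg V A (\<phi> u) (\<phi> v) < s"
      by (auto simp: homs_def ishom_def heavy_def not_le)
    then have "(\<phi>, u, v) \<in> ?L" by (auto simp: flags_def)
    then show "\<phi> \<in> fst ` ?L" by force
  qed
  have finL: "finite ?L" by (rule finite_subset[OF _ finite_flags[OF assms(1), of A]]) auto
  have "card ?D \<le> card ?L"
    using card_mono[OF finite_imageI[OF finL] img] card_image_le[OF finL, of fst] by simp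
  then have "real (card ?D) \<le> real (card ?L)" by simp
  also have "\<dots> = (\<Sum>(\<phi>, u, v)\<in>flags V A. of_bool (codeg V A (\<phi> u) (\<phi> v) < s))"
    using finite_flags[OF assms(1), of A] by (simp add: of_bool_def sum.If_cases split_def Int_def)
  also have "\<dots> = (\<Sum>p\<in>V \<times> V. of_bool (codeg V A (fst p) (snd p) < s) * codeg V A (fst p) (snd p))"
    by (rule sum_flags[OF assms(1)])
  also have "\<dots> \<le> (\<Sum>p\<in>V \<times> V. s)"
    using assms by (intro sum_mono) auto
  also have "\<dots> = s * real (card V) ^ 2"
    by (simp add: card_cartesian_product power2_eq_square)
  finally show ?thesis .
qed

lemma near_opt_heavy:
  assumes "near_opt r V A d" "finite V" "0 \<le> s"
  shows "near_opt r V (heavy V A s) (d + s * real (card V) ^ 2)"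
proof -
  have sub: "homs V (heavy V A s) \<subseteq> homs V A"
    by (rule homs_mono) (simp add: heavy_def)
  have "card (homs V A) = card (homs V (heavy V A s)) + card (homs V A - homs V (heavy V A s))"
    using card_Diff_subset[OF finite_subset[OF sub finite_homs[OF assms(2)]] sub]
      card_mono[OF finite_homs[OF assms(2)] sub] by simp
  then have "real (card (homs V A)) \<le> real (card (homs V (heavy V A s))) + s * real (card V) ^ 2"
    using card_homs_heavy[OF assms(2,3), of A] by simp
  moreover have "clique_free r V (heavy V A s)"
    using assms(1) by (auto simp: near_opt_def heavy_def intro: clique_free_mono)
  ultimately show ?thesis
    using assms(1) rel_graph_heavy[of A V s] unfolding near_opt_def by (smt (verit))
qed

text \<open>A bad triple whose edge carries at least \<open>s\<close> flags is paid for by that many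
  bad flags of \<open>A\<close>; the other edges are medium and are charged \<open>s\<close> for
  each \<open>x\<close>. Since \<open>bad_sum\<close> sees only flags of the thinned graph, those
  over deleted homomorphisms are added back, at most \<open>card VH\<close> squared for each of them
  and each \<open>x\<close>.\<close>

lemma card_bad_triples_heavy:
  assumes fin: "finite V" and s: "0 \<le> s'" "0 \<le> s"
  defines "n \<equiv> real (card V)"
  shows "s * real (card (bad_triples V (heavy V A s')))
    \<le> bad_sum V (heavy V A s') + n * (real (card VH) ^ 2 * (s' * n\<^sup>2)) + s * n * real (card (medium V A s' s))"
proof -
  let ?B = "heavy V A s'"
  let ?P = "\<lambda>x a b. \<not> ?B a x \<and> \<not> ?B b x"
  have sub: "homs V ?B \<subseteq> homs V A" by (rule homs_mono) (simp add: heavy_def)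
  have subF: "flags V ?B \<subseteq> flags V A" using sub by (auto simp: flags_def)
  have "flags V A - flags V ?B \<subseteq> (homs V A - homs V ?B) \<times> VH \<times> VH" by (auto simp: flags_def)
  then have "card (flags V A - flags V ?B) \<le> card ((homs V A - homs V ?B) \<times> VH \<times> VH)"
    using finite_homs[OF fin] finVH by (intro card_mono) auto
  then have "real (card (flags V A - flags V ?B)) \<le> real (card (homs V A - homs V ?B)) * (real (card VH) ^ 2)"
    by (simp add: card_cartesian_product power2_eq_square flip: of_nat_mult)
  also have "\<dots> \<le> (s' * n\<^sup>2) * real (card VH) ^ 2"
    using card_homs_heavy[OF fin s(1)] by (intro mult_right_mono) (auto simp: n_def)
  finally have lost: "real (card (flags V A - flags V ?B)) \<le> real (card VH) ^ 2 * (s' * n\<^sup>2)"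
    by (simp add: mult.commute)
  have tri: "real (card (bad_triples V ?B)) = (\<Sum>x\<in>V. \<Sum>p\<in>V \<times> V. of_bool (?P x (fst p) (snd p) \<and> ?B (fst p) (snd p)))"
  proof -
    have "bad_triples V ?B \<subseteq> V \<times> V \<times> V" by (auto simp: bad_triples_def)
    from card_fibres_triples(1)[OF fin this]
    have "real (card (bad_triples V ?B)) = (\<Sum>x\<in>V. real (card {(y, z). (x, y, z) \<in> bad_triples V ?B}))"
      unfolding of_nat_sum[symmetric] by simp
    also have "\<dots> = (\<Sum>x\<in>V. real (card {(y, z). y \<in> V \<and> z \<in> V \<and> ?P x y z \<and> ?B y z}))"
      by (intro sum.cong arg_cong[where f = "\<lambda>X. real (card X)"]) (auto simp: bad_triples_def)
    finally show ?thesis using card_Collect_pairs[OF fin] by simp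
  qed
  have "s * real (card (bad_triples V ?B))
      \<le> (\<Sum>x\<in>V. (\<Sum>p\<in>V \<times> V. of_bool (?P x (fst p) (snd p)) * codeg V A (fst p) (snd p))
          + s * real (card (medium V A s' s)))"
    unfolding tri sum_distrib_left[of s]
  proof (rule sum_mono)
    fix x
    have "(\<Sum>p\<in>V \<times> V. s * of_bool (?P x (fst p) (snd p) \<and> ?B (fst p) (snd p)))
      \<le> (\<Sum>p\<in>V \<times> V. of_bool (?P x (fst p) (snd p)) * codeg V A (fst p) (snd p)
          + s * of_bool (A (fst p) (snd p) \<and> s' \<le> codeg V A (fst p) (snd p) \<and> codeg V A (fst p) (snd p) < s))"
    proof (rule sum_mono)
      fix p
      have "0 \<le> codeg V A (fst p) (snd p)" by (simp add: codeg_def)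
      then show "s * of_bool (?P x (fst p) (snd p) \<and> ?B (fst p) (snd p))
        \<le> of_bool (?P x (fst p) (snd p)) * codeg V A (fst p) (snd p)
          + s * of_bool (A (fst p) (snd p) \<and> s' \<le> codeg V A (fst p) (snd p) \<and> codeg V A (fst p) (snd p) < s)"
        using s by (cases "codeg V A (fst p) (snd p) < s") (auto simp: heavy_def)
    qed
    also have "\<dots> = (\<Sum>p\<in>V \<times> V. of_bool (?P x (fst p) (snd p)) * codeg V A (fst p) (snd p))
          + s * real (card (medium V A s' s))"
      unfolding sum.distrib medium_def by (simp add: card_Collect_pairs[OF fin] sum_distrib_left)
    finally show "(\<Sum>p\<in>V \<times> V. s * of_bool (?P x (fst p) (snd p) \<and> ?B (fst p) (snd p)))
      \<le> (\<Sum>p\<in>V \<times> V. of_bool (?P x (fst p) (snd p)) * codeg V A (fst p) (snd p))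
          + s * real (card (medium V A s' s))" .
  qed
  also have "\<dots> = (\<Sum>x\<in>V. \<Sum>(\<phi>, u, v)\<in>flags V A. of_bool (?P x (\<phi> u) (\<phi> v))) + s * n * real (card (medium V A s' s))"
    by (simp add: sum.distrib n_def sum_flags[OF fin, of "\<lambda>a b. of_bool (?P _ a b)"])
  also have "(\<Sum>x\<in>V. \<Sum>(\<phi>, u, v)\<in>flags V A. of_bool (?P x (\<phi> u) (\<phi> v)))
      \<le> (\<Sum>x\<in>V. (\<Sum>(\<phi>, u, v)\<in>flags V ?B. of_bool (?P x (\<phi> u) (\<phi> v))) + real (card VH) ^ 2 * (s' * n\<^sup>2))"
  proof (rule sum_mono)
    fix x
    let ?g = "\<lambda>(\<phi>, u, v). of_bool (?P x (\<phi> u) (\<phi> v)) :: real"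
    have "sum ?g (flags V A) = sum ?g (flags V A - flags V ?B) + sum ?g (flags V ?B)"
      by (rule sum.subset_diff[OF subF finite_flags[OF fin]])
    moreover have "sum ?g (flags V A - flags V ?B) \<le> real (card (flags V A - flags V ?B)) * 1"
      by (rule sum_bounded_above) auto
    ultimately show "sum ?g (flags V A) \<le> sum ?g (flags V ?B) + real (card VH) ^ 2 * (s' * n\<^sup>2)"
      using lost by linarith
  qed
  also have "\<dots> = bad_sum V ?B + n * (real (card VH) ^ 2 * (s' * n\<^sup>2))"
    by (simp add: sum.distrib bad_sum_flags[OF fin] n_def)
  finally show ?thesis by simp
qed

end

text \<open>Few vertices miss many neighbours in other classes; \<open>B\<close> collects them. An
  edge inside a class that avoids \<open>B\<close> extends greedily, by one vertex from each other
  class, to a clique on \<open>r + 1\<close> vertices, because a class is larger than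
  \<open>B\<close> together with the cross non-neighbours of the vertices chosen so far. So every
  edge inside a class meets \<open>B\<close>.\<close>

lemma few_edges_inside_classes:
  fixes V :: "'b set"
  assumes graph: "rel_graph A" "clique_free r V A" and fin: "finite V"
    and col: "\<forall>y\<in>V. c y < r"
  defines "n \<equiv> real (card V)"
  assumes large: "\<forall>i<r. c0 * n \<le> real (card {y \<in> V. c y = i})"
    and \<theta>: "0 < \<theta>" "real (r + 1) * \<theta> + \<epsilon> / \<theta> < c0"
    and cross: "real (card {(y, z). y \<in> V \<and> z \<in> V \<and> c y \<noteq> c z \<and> \<not> A y z}) \<le> \<epsilon> * n\<^sup>2"
  shows "real (card {(y, z). y \<in> V \<and> z \<in> V \<and> c y = c z \<and> A y z}) \<le> 2 * (\<epsilon> / \<theta>) * n\<^sup>2"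
proof (cases "V = {}")
  case True
  then show ?thesis by (simp add: n_def)
next
  case False
  then have n0: "n > 0" using fin by (simp add: n_def card_gt_0_iff)
  have sym: "A a b = A b a" for a b using graph by (auto simp: rel_graph_def)
  let ?X = "{(y, z). y \<in> V \<and> z \<in> V \<and> c y \<noteq> c z \<and> \<not> A y z}"
  let ?q = "\<lambda>y. {z \<in> V. c y \<noteq> c z \<and> \<not> A y z}"
  define B where "B = {y \<in> V. \<theta> * n \<le> real (card (?q y))}"
  have finB: "finite B" "B \<subseteq> V" using fin by (auto simp: B_def)
  have X: "?X = Sigma V ?q" by auto
  have "real (card B) * (\<theta> * n) \<le> (\<Sum>y\<in>B. real (card (?q y)))"
    using sum_bounded_below[of B "\<theta> * n" "\<lambda>y. real (card (?q y))"] by (simp add: B_def)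
  also have "\<dots> \<le> (\<Sum>y\<in>V. real (card (?q y)))"
    using fin finB by (intro sum_mono2) auto
  also have "\<dots> = real (card ?X)"
    unfolding X using fin by (subst card_SigmaI) auto
  also have "\<dots> \<le> (\<epsilon> * n) * n" using cross by (simp add: power2_eq_square)
  finally have "real (card B) * \<theta> \<le> \<epsilon> * n"
    using n0 by (simp flip: mult.assoc)
  then have cB: "real (card B) \<le> \<epsilon> / \<theta> * n"
    using \<theta>(1) by (simp add: field_simps)
  have touch: "y \<in> B \<or> z \<in> B" if yz: "y \<in> V" "z \<in> V" "c y = c z" "A y z" for y z
  proof (rule ccontr)
    assume nB: "\<not> (y \<in> B \<or> z \<in> B)"
    have ne: "y \<noteq> z" using yz graph by (auto simp: rel_graph_def)
    \<comment> \<open>Induction on the set \<open>J\<close> of further colours already represented.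
      Since \<open>y\<close> and \<open>z\<close> share a colour, the clique has two vertices more
      than \<open>J\<close> has colours, hence \<open>r + 1\<close> vertices once \<open>J\<close>
      contains all other colours.\<close>
    have grow: "\<exists>K. K \<subseteq> V - B \<and> finite K \<and> card K = card J + 2 \<and> c ` K \<subseteq> insert (c y) J
        \<and> (\<forall>a\<in>K. \<forall>b\<in>K. a \<noteq> b \<longrightarrow> A a b)"
      if "finite J" "J \<subseteq> {..<r} - {c y}" for J
      using that
    proof (induction J)
      case empty
      show ?case using yz nB ne sym by (intro exI[of _ "{y, z}"]) auto
    next
      case (insert j J)
      then obtain K where K: "K \<subseteq> V - B" "finite K" "card K = card J + 2" "c ` K \<subseteq> insert (c y) J"
        "\<forall>a\<in>K. \<forall>b\<in>K. a \<noteq> b \<longrightarrow> A a b" by auto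
      let ?C = "{w \<in> V. c w = j}"
      have jr: "j < r" "j \<noteq> c y" "j \<notin> J" using insert by auto
      have "card J < r"
      proof -
        have "card (insert j J) \<le> card ({..<r} - {c y})"
          using insert.prems by (intro card_mono) auto
        also have "\<dots> < r" using jr col yz(1) by simp
        finally show ?thesis using insert.hyps by simp
      qed
      then have cK: "card K \<le> r + 1" using K(3) by simp
      have "card (B \<union> (\<Union>w\<in>K. ?q w)) \<le> card B + (\<Sum>w\<in>K. card (?q w))"
        using card_Un_le[of B "\<Union>w\<in>K. ?q w"] card_UN_le[OF K(2), of ?q] by linarith
      then have "real (card (B \<union> (\<Union>w\<in>K. ?q w))) \<le> real (card B) + (\<Sum>w\<in>K. real (card (?q w)))"
        by (simp flip: of_nat_sum of_nat_add)
      also have "(\<Sum>w\<in>K. real (card (?q w))) \<le> real (card K) * (\<theta> * n)"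
        using K(1) by (intro sum_bounded_above) (auto simp: B_def)
      also have "\<dots> \<le> real (r + 1) * (\<theta> * n)"
        using cK \<theta>(1) n0 by (intro mult_right_mono) auto
      finally have "real (card (B \<union> (\<Union>w\<in>K. ?q w))) \<le> (real (r + 1) * \<theta> + \<epsilon> / \<theta>) * n"
        using cB by (simp add: distrib_right)
      also have "\<dots> < c0 * n" using \<theta>(2) n0 by simp
      also have "\<dots> \<le> real (card ?C)" using large jr by simp
      finally have "\<not> ?C \<subseteq> B \<union> (\<Union>w\<in>K. ?q w)"
        using card_mono[of "B \<union> (\<Union>w\<in>K. ?q w)" ?C] finB fin K(2) by auto
      then obtain w where w: "w \<in> V" "c w = j" "w \<notin> B" "\<forall>a\<in>K. w \<notin> ?q a" by blast
      have adj: "A a w" if "a \<in> K" for a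
      proof -
        have "c a \<noteq> c w" using K(4) that w(2) jr by auto
        then show ?thesis using w that by auto
      qed
      have "w \<notin> K" using K(4) w(2) jr by auto
      then show ?case
        using K w adj sym insert.hyps by (intro exI[of _ "insert w K"]) auto
    qed
    have "finite ({..<r} - {c y})" by simp
    from grow[OF this order_refl] obtain K where K: "K \<subseteq> V - B" "card K = card ({..<r} - {c y}) + 2"
      "\<forall>a\<in>K. \<forall>b\<in>K. a \<noteq> b \<longrightarrow> A a b" by metis
    have "K \<subseteq> V" using K(1) by blast
    then have "card K \<le> r" using K(3) graph(2) unfolding clique_free_def by simp
    moreover have "card ({..<r} - {c y}) = r - 1" "r > 0" using col yz(1) by auto
    ultimately show False using K(2) by simp
  qed
  let ?I = "{(y, z). y \<in> V \<and> z \<in> V \<and> c y = c z \<and> A y z}"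
  have "?I \<subseteq> B \<times> V \<union> V \<times> B" using touch by auto
  then have "card ?I \<le> card (B \<times> V \<union> V \<times> B)"
    using fin finB by (intro card_mono) auto
  also have "\<dots> \<le> card (B \<times> V) + card (V \<times> B)" by (rule card_Un_le)
  finally have "card ?I \<le> 2 * (card B * card V)" by (simp add: card_cartesian_product mult.commute)
  then have "real (card ?I) \<le> real (2 * (card B * card V))" by (simp only: of_nat_le_iff)
  then have "real (card ?I) \<le> 2 * (real (card B) * n)" by (simp add: n_def)
  also have "\<dots> \<le> 2 * ((\<epsilon> / \<theta> * n) * n)"
    using cB n0 by (intro mult_left_mono mult_right_mono) auto
  finally show ?thesis by (simp add: power2_eq_square)
qed

lemma clique_free_colouring:
  assumes "\<forall>y\<in>V. c y < r"
  shows "clique_free r V (\<lambda>x y. c x \<noteq> c y)"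
  unfolding clique_free_def
proof (intro allI impI)
  fix K assume K: "K \<subseteq> V" "\<forall>x\<in>K. \<forall>y\<in>K. x \<noteq> y \<longrightarrow> c x \<noteq> c y"
  then have "inj_on c K" by (auto simp: inj_on_def)
  moreover have "c ` K \<subseteq> {..<r}" using K assms by auto
  ultimately show "card K \<le> r" by (metis card_image card_lessThan card_mono finite_lessThan)
qed

lemma rel_graph_colouring: "rel_graph (\<lambda>x y. c x \<noteq> c y)"
  by (auto simp: rel_graph_def)

section \<open>Choice of the threshold for light edges\<close>

context multipartite_pattern
begin

lemma power_split: "(x :: real) ^ (card VH - 2) * x\<^sup>2 = x ^ card VH"
  using card_VH_ge2 by (metis le_add_diff_inverse2 power_add)

lemma near_opt_mono: "near_opt r V A d \<Longrightarrow> d \<le> d' \<Longrightarrow> near_opt r V A d'"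
  by (force simp: near_opt_def)

text \<open>The budget is \<open>\<eta> * \<beta>\<close> times n^(h + 1). Medium edges take half of
  it, deleted homomorphisms an eighth and the second-order estimate three eighths. The single number
  \<open>\<eta>'\<close> is both the slack in optimality and the deletion threshold, which is why
  the slack doubles.\<close>

lemma heavy_few_bad_triples:
  fixes \<beta> \<eta> :: real
  assumes \<beta>: "0 < \<beta>" and \<eta>: "0 < \<eta>"
  shows "\<exists>\<eta>' n0. 0 < \<eta>' \<and> \<eta>' \<le> \<eta> \<and> (\<forall>(V :: 'b set) A. finite V \<and> n0 \<le> card V
    \<and> near_opt r V A (\<eta>' * real (card V) ^ card VH)
    \<and> real (card (medium V A (\<eta>' * real (card V) ^ (card VH - 2)) (\<eta> * real (card V) ^ (card VH - 2))))
        \<le> \<beta> / 2 * real (card V) ^ 2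
    \<longrightarrow> near_opt r V (heavy V A (\<eta>' * real (card V) ^ (card VH - 2))) (2 * \<eta>' * real (card V) ^ card VH)
      \<and> real (card (bad_triples V (heavy V A (\<eta>' * real (card V) ^ (card VH - 2))))) \<le> \<beta> * real (card V) ^ 3)"
proof -
  define h where "h = real (card VH)"
  have h1: "h \<ge> 1" using card_VH_ge2 by (simp add: h_def)
  define C where "C = (1 + 2 * h ^ 3) * h\<^sup>2"
  have C0: "C > 0" unfolding C_def using h1 by (intro mult_pos_pos add_pos_pos) auto
  \<comment> \<open>Makes the cubic remainder 2 h^3 t^3 at most
    \<open>t\<^sup>2 * (\<eta> * \<beta>) / 16\<close>, the share of each of the three losses in
    \<open>bad_sum_le\<close>. The second bound on \<open>\<eta>'\<close> and the choice of
    \<open>n0\<close> do the same for the slack and the non-injective maps; the third bound on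
    \<open>\<eta>'\<close> is for the deleted homomorphisms.\<close>
  define t where "t = min 1 (\<eta> * \<beta> / (32 * h ^ 3))"
  have t: "0 < t" "t \<le> 1" "t \<le> \<eta> * \<beta> / (32 * h ^ 3)"
    using h1 \<beta> \<eta> by (auto simp: t_def)
  define \<eta>' where "\<eta>' = min \<eta> (min (\<eta> * \<beta> * t\<^sup>2 / 32) (\<eta> * \<beta> / (8 * h\<^sup>2)))"
  have \<eta>': "0 < \<eta>'" "\<eta>' \<le> \<eta>" "\<eta>' \<le> \<eta> * \<beta> * t\<^sup>2 / 32" "\<eta>' \<le> \<eta> * \<beta> / (8 * h\<^sup>2)"
    using h1 \<beta> \<eta> t by (auto simp: \<eta>'_def)
  define n0 where "n0 = nat \<lceil>16 * C / (t\<^sup>2 * (\<eta> * \<beta>))\<rceil> + 1"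
  have main: "near_opt r V (heavy V A (\<eta>' * n ^ (card VH - 2))) (2 * \<eta>' * n ^ card VH)
      \<and> real (card (bad_triples V (heavy V A (\<eta>' * n ^ (card VH - 2))))) \<le> \<beta> * n ^ 3"
    if fin: "finite V" and big: "n0 \<le> card V" and n_def: "n = real (card V)"
      and opt: "near_opt r V A (\<eta>' * n ^ card VH)"
      and med: "real (card (medium V A (\<eta>' * n ^ (card VH - 2)) (\<eta> * n ^ (card VH - 2)))) \<le> \<beta> / 2 * n\<^sup>2"
    for V :: "'b set" and A n
  proof -
    define s' where "s' = \<eta>' * n ^ (card VH - 2)"
    define s where "s = \<eta> * n ^ (card VH - 2)"
    define N where "N = n ^ (card VH + 1)"
    let ?B = "heavy V A s'"
    have n_pos: "n > 0" using big by (simp add: n_def n0_def)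
    have N_pos: "N > 0" using n_pos by (simp add: N_def)
    have s0: "0 \<le> s'" "0 \<le> s" using \<eta>' \<eta> n_pos by (auto simp: s'_def s_def)
    have s'n: "s' * n\<^sup>2 = \<eta>' * n ^ card VH"
      by (simp add: s'_def power_split mult.assoc)
    have N_eq: "n * n ^ card VH = N" "n ^ (card VH - 2) * n ^ 3 = N"
    proof -
      show "n * n ^ card VH = N" by (simp add: N_def)
      then show "n ^ (card VH - 2) * n ^ 3 = N"
        using power_split[of n] by (simp add: power3_eq_cube power2_eq_square mult_ac)
    qed
    have optB: "near_opt r V ?B (2 * \<eta>' * n ^ card VH)"
      using near_opt_heavy[OF opt fin s0(1)] s'n by (simp add: n_def mult.assoc)
    have "16 * C / (t\<^sup>2 * (\<eta> * \<beta>)) \<le> n"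
      using big unfolding n0_def n_def by linarith
    then have "16 * C \<le> n * (t\<^sup>2 * (\<eta> * \<beta>))"
      using t \<eta> \<beta> by (simp add: field_simps)
    then have "C * n ^ card VH \<le> (n * (t\<^sup>2 * (\<eta> * \<beta>)) / 16) * n ^ card VH"
      using n_pos by (intro mult_right_mono) auto
    then have e3: "C * n ^ card VH \<le> (t\<^sup>2 * (\<eta> * \<beta>) / 16) * N"
      by (simp flip: N_eq(1) add: mult_ac)
    have "2 * \<eta>' \<le> t\<^sup>2 * (\<eta> * \<beta>) / 16" using \<eta>'(3) by (simp add: mult_ac)
    then have e1: "n * (2 * \<eta>' * n ^ card VH) \<le> (t\<^sup>2 * (\<eta> * \<beta>) / 16) * N"
      using mult_right_mono[of "2 * \<eta>'" "t\<^sup>2 * (\<eta> * \<beta>) / 16" N] N_pos by (simp flip: N_eq(1) add: mult_ac)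
    have "32 * h ^ 3 * t \<le> \<eta> * \<beta>" using t(3) h1 by (simp add: field_simps)
    then have "t\<^sup>2 * (32 * h ^ 3 * t) \<le> t\<^sup>2 * (\<eta> * \<beta>)" by (intro mult_left_mono) auto
    then have "2 * h ^ 3 * t ^ 3 \<le> t\<^sup>2 * (\<eta> * \<beta>) / 16"
      by (simp add: power2_eq_square power3_eq_cube mult_ac)
    then have e2: "2 * h ^ 3 * t ^ 3 * N \<le> (t\<^sup>2 * (\<eta> * \<beta>) / 16) * N"
      using N_pos by (intro mult_right_mono) auto
    have "t\<^sup>2 / 2 * bad_sum V ?B
        \<le> n * (2 * \<eta>' * n ^ card VH) + 2 * h ^ 3 * t ^ 3 * N + C * n ^ card VH"
      using bad_sum_le[OF optB fin] t unfolding n_def h_def C_def N_def by simp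
    also have "\<dots> \<le> t\<^sup>2 / 2 * (3 / 8 * (\<eta> * \<beta> * N))"
      using e1 e2 e3 by (simp add: mult_ac)
    finally have bs: "bad_sum V ?B \<le> 3 / 8 * (\<eta> * \<beta> * N)"
      by (rule mult_left_le_imp_le) (use t(1) in simp)
    have "h\<^sup>2 * \<eta>' \<le> \<eta> * \<beta> / 8" using \<eta>'(4) h1 by (simp add: field_simps)
    then have "h\<^sup>2 * \<eta>' * N \<le> \<eta> * \<beta> / 8 * N" using N_pos by (intro mult_right_mono) auto
    then have e4: "n * (h\<^sup>2 * (s' * n\<^sup>2)) \<le> 1 / 8 * (\<eta> * \<beta> * N)"
      unfolding s'n by (simp flip: N_eq(1) add: mult_ac)
    have "s * n * real (card (medium V A s' s)) \<le> s * n * (\<beta> / 2 * n\<^sup>2)"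
      using med s0 n_pos by (intro mult_left_mono) (auto simp: s_def s'_def)
    also have "\<dots> = 1 / 2 * (\<eta> * \<beta> * N)"
      by (simp add: s_def power3_eq_cube power2_eq_square flip: N_eq(2))
    finally have "s * real (card (bad_triples V ?B)) \<le> \<eta> * \<beta> * N"
      using card_bad_triples_heavy[OF fin s0, of A] bs e4 unfolding h_def n_def by linarith
    also have "\<dots> = s * (\<beta> * n ^ 3)" by (simp add: s_def flip: N_eq(2))
    finally have "real (card (bad_triples V ?B)) \<le> \<beta> * n ^ 3"
      using \<eta> n_pos by (simp add: s_def)
    then show ?thesis using optB by (simp add: s'_def)
  qed
  show ?thesis
    by (rule exI[of _ \<eta>'], rule exI[of _ n0]) (use \<eta>' main in blast)
qed

text \<open>Thresholds \<open>\<eta>\<^sub>0 > \<eta>\<^sub>1 > \<dots>\<close> cut the edges into disjoint layers by the number of copies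
  through them; some layer is thin, and the lighter edges below it can be discarded.\<close>

lemma near_opt_few_bad_triples:
  fixes \<beta> d :: real
  assumes \<beta>: "0 < \<beta>" and d: "0 < d"
  shows "\<exists>\<delta> n0. 0 < \<delta> \<and> (\<forall>(V :: 'b set) A. finite V \<and> n0 \<le> card V \<and> near_opt r V A (\<delta> * real (card V) ^ card VH)
    \<longrightarrow> (\<exists>A'. (\<forall>x y. A' x y \<longrightarrow> A x y) \<and> near_opt r V A' (d * real (card V) ^ card VH)
      \<and> real (card (bad_triples V A')) \<le> \<beta> * real (card V) ^ 3))"
proof -
  define good where "good \<eta> \<eta>' n0 \<longleftrightarrow> (\<forall>(V :: 'b set) A. finite V \<and> n0 \<le> card V
    \<and> near_opt r V A (\<eta>' * real (card V) ^ card VH)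
    \<and> real (card (medium V A (\<eta>' * real (card V) ^ (card VH - 2)) (\<eta> * real (card V) ^ (card VH - 2))))
        \<le> \<beta> / 2 * real (card V) ^ 2
    \<longrightarrow> near_opt r V (heavy V A (\<eta>' * real (card V) ^ (card VH - 2))) (2 * \<eta>' * real (card V) ^ card VH)
      \<and> real (card (bad_triples V (heavy V A (\<eta>' * real (card V) ^ (card VH - 2))))) \<le> \<beta> * real (card V) ^ 3)"
    for \<eta> \<eta>' :: real and n0 :: nat
  have "\<forall>\<eta>>0. \<exists>\<eta>' n0. 0 < \<eta>' \<and> \<eta>' \<le> \<eta> \<and> good \<eta> \<eta>' n0"
    using heavy_few_bad_triples[OF \<beta>] unfolding good_def by blast
  then obtain f M where fM: "\<And>\<eta>. \<eta> > 0 \<Longrightarrow> 0 < f \<eta> \<and> f \<eta> \<le> \<eta> \<and> good \<eta> (f \<eta>) (M \<eta>)"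
    by metis
  \<comment> \<open>The thresholds start at \<open>d / 2\<close> because deleting light edges
    doubles the slack.\<close>
  define e where "e i = (f ^^ i) (d / 2)" for i
  have e_Suc: "e (Suc i) = f (e i)" for i by (simp add: e_def)
  have e_pos: "0 < e i" for i
    by (induction i) (use d fM in \<open>auto simp: e_def\<close>)
  have e_dec: "e j \<le> e i" if "i \<le> j" for i j
    using that by (induction j rule: dec_induct) (use e_pos fM e_Suc in \<open>auto intro: order_trans\<close>)
  \<comment> \<open>So many disjoint layers, each with more than
    \<open>\<beta> / 2 * n\<^sup>2\<close> pairs, would exceed the \<open>n\<^sup>2\<close> pairs
    available.\<close>
  define m where "m = nat \<lceil>2 / \<beta>\<rceil> + 1"
  have m: "real m * (\<beta> / 2) \<ge> 1"
  proof -
    have "2 / \<beta> \<le> real m" unfolding m_def by linarith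
    then show ?thesis using \<beta> by (simp add: field_simps)
  qed
  \<comment> \<open>Which layer is thin depends on the graph, so \<open>n0\<close> must serve all of
    them. Likewise optimality is demanded at the last threshold \<open>e m\<close> and relaxed to
    the one in use.\<close>
  define n0 where "n0 = (\<Sum>i<m. M (e i)) + 1"
  have main: "\<exists>A'. (\<forall>x y. A' x y \<longrightarrow> A x y) \<and> near_opt r V A' (d * n ^ card VH)
      \<and> real (card (bad_triples V A')) \<le> \<beta> * n ^ 3"
    if fin: "finite V" and big: "n0 \<le> card V" and n_def: "n = real (card V)"
      and opt: "near_opt r V A (e m * n ^ card VH)" for V :: "'b set" and A n
  proof -
    have n_pos: "n > 0" using big by (simp add: n_def n0_def)
    define L where "L i = medium V A (e (Suc i) * n ^ (card VH - 2)) (e i * n ^ (card VH - 2))" for i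
    have "\<exists>i<m. real (card (L i)) \<le> \<beta> / 2 * n\<^sup>2"
    proof (rule ccontr)
      assume "\<not> ?thesis"
      then have gt: "\<beta> / 2 * n\<^sup>2 < real (card (L i))" if "i < m" for i using that by force
      have finL: "finite (L i)" for i
        by (rule finite_subset[of _ "V \<times> V"]) (use fin in \<open>auto simp: L_def medium_def\<close>)
      have disj: "L i \<inter> L j = {}" if "i < j" for i j
      proof -
        have "e j * n ^ (card VH - 2) \<le> e (Suc i) * n ^ (card VH - 2)"
          using e_dec[of "Suc i" j] that n_pos by (intro mult_right_mono) auto
        then show ?thesis by (auto simp: L_def medium_def)
      qed
      have "(\<Sum>i<m. \<beta> / 2 * n\<^sup>2) < (\<Sum>i<m. real (card (L i)))"
        using gt by (intro sum_strict_mono) (auto simp: m_def)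
      also have "\<dots> = real (card (\<Union>i<m. L i))"
      proof -
        have "L i \<inter> L j = {}" if "i \<noteq> j" for i j
          using disj[of i j] disj[of j i] that by (cases i j rule: linorder_cases) auto
        then show ?thesis using finL by (subst card_UN_disjoint) auto
      qed
      also have "card (\<Union>i<m. L i) \<le> card (V \<times> V)"
        using fin by (intro card_mono) (auto simp: L_def medium_def)
      then have "real (card (\<Union>i<m. L i)) \<le> n\<^sup>2"
        unfolding n_def by (simp add: card_cartesian_product power2_eq_square flip: of_nat_mult)
      finally have "(real m * (\<beta> / 2)) * n\<^sup>2 < 1 * n\<^sup>2" by simp
      moreover have "1 * n\<^sup>2 \<le> (real m * (\<beta> / 2)) * n\<^sup>2" using m by (intro mult_right_mono) auto
      ultimately show False by linarith
    qed
    then obtain i where i: "i < m" "real (card (L i)) \<le> \<beta> / 2 * n\<^sup>2" by blast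
    have "M (e i) \<le> (\<Sum>i<m. M (e i))" using i(1) by (intro member_le_sum) auto
    then have Mi: "M (e i) \<le> card V" using big by (simp add: n0_def)
    have "e m * n ^ card VH \<le> e (Suc i) * n ^ card VH"
      using e_dec[of "Suc i" m] i(1) n_pos by (intro mult_right_mono) auto
    then have opt': "near_opt r V A (e (Suc i) * n ^ card VH)" using near_opt_mono[OF opt] by blast
    have "good (e i) (e (Suc i)) (M (e i))" using fM[OF e_pos] by (simp add: e_Suc)
    then have *: "near_opt r V (heavy V A (e (Suc i) * n ^ (card VH - 2))) (2 * e (Suc i) * n ^ card VH)
      \<and> real (card (bad_triples V (heavy V A (e (Suc i) * n ^ (card VH - 2))))) \<le> \<beta> * n ^ 3"
      using fin Mi opt' i(2) unfolding good_def n_def L_def by blast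
    have "2 * e (Suc i) \<le> d" using e_dec[of 0 "Suc i"] by (simp add: e_def)
    then have "2 * e (Suc i) * n ^ card VH \<le> d * n ^ card VH"
      using n_pos by (intro mult_right_mono) auto
    then have "near_opt r V (heavy V A (e (Suc i) * n ^ (card VH - 2))) (d * n ^ card VH)"
      using * near_opt_mono by blast
    then show ?thesis using *
      by (intro exI[of _ "heavy V A (e (Suc i) * n ^ (card VH - 2))"]) (auto simp: heavy_def)
  qed
  show ?thesis
    by (rule exI[of _ "e m"], rule exI[of _ n0]) (use e_pos main in blast)
qed

text \<open>A homomorphism into \<open>A\<close> that the multipartite graph does not admit sends an
  edge of \<open>H\<close> to an edge of \<open>A\<close> inside a colour class. That is an error
  pair, and each error pair lies under at most h^2 n^(h - 2) maps.\<close>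

lemma near_opt_colouring:
  assumes opt: "near_opt r V A d" and fin: "finite V" and col: "\<forall>y\<in>V. c y < r"
    and err: "real (card (colour_errors V A c)) \<le> \<epsilon> * real (card V) ^ 2"
  shows "near_opt r V (\<lambda>x y. c x \<noteq> c y) (d + real (card VH) ^ 2 * \<epsilon> * real (card V) ^ card VH)"
proof -
  let ?T = "\<lambda>x y. c x \<noteq> c y"
  let ?h = "real (card VH)" and ?n = "real (card V)"
  let ?P = "\<lambda>a b. A a b \<and> c a = c b"
  let ?X = "{\<phi> \<in> VH \<rightarrow>\<^sub>E V. \<exists>u\<in>VH. \<exists>v\<in>VH. u \<noteq> v \<and> ?P (\<phi> u) (\<phi> v)}"
  let ?Y = "{(a, b). a \<in> V \<and> b \<in> V \<and> ?P a b}"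
  have "homs V A \<subseteq> homs V ?T \<union> ?X"
  proof
    fix \<phi> assume \<phi>: "\<phi> \<in> homs V A"
    show "\<phi> \<in> homs V ?T \<union> ?X"
    proof (cases "\<phi> \<in> homs V ?T")
      case False
      then obtain u v where "u \<in> VH" "v \<in> VH" "cH u \<noteq> cH v" "c (\<phi> u) = c (\<phi> v)"
        using \<phi> by (auto simp: homs_def ishom_def)
      moreover from this have "A (\<phi> u) (\<phi> v)" "u \<noteq> v" using \<phi> by (auto simp: homs_def ishom_def)
      ultimately show ?thesis using \<phi> by (auto simp: homs_def)
    qed simp
  qed
  then have "card (homs V A) \<le> card (homs V ?T \<union> ?X)"
    using finite_homs[OF fin] finite_maps[OF fin] by (intro card_mono) auto
  also have "\<dots> \<le> card (homs V ?T) + card ?X" by (rule card_Un_le)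
  finally have 1: "real (card (homs V A)) \<le> real (card (homs V ?T)) + real (card ?X)" by simp
  have "card ?X \<le> (card VH)\<^sup>2 * (card ?Y * card V ^ (card VH - 2))"
    by (rule card_PiE_hits_pairs[OF finVH fin])
  then have "real (card ?X) \<le> real ((card VH)\<^sup>2 * (card ?Y * card V ^ (card VH - 2)))"
    by (simp only: of_nat_le_iff)
  also have "\<dots> = ?h\<^sup>2 * (real (card ?Y) * ?n ^ (card VH - 2))" by simp
  also have "\<dots> \<le> ?h\<^sup>2 * ((\<epsilon> * ?n\<^sup>2) * ?n ^ (card VH - 2))"
  proof (intro mult_left_mono mult_right_mono)
    have "card ?Y \<le> card (colour_errors V A c)"
      using finite_colour_errors[OF fin] by (intro card_mono) (auto simp: colour_errors_def)
    then show "real (card ?Y) \<le> \<epsilon> * ?n\<^sup>2" using err by linarith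
  qed auto
  also have "\<dots> = ?h\<^sup>2 * \<epsilon> * ?n ^ card VH"
    using power_split[of ?n] by (simp add: mult_ac)
  finally have "real (card (homs V A)) \<le> real (card (homs V ?T)) + ?h\<^sup>2 * \<epsilon> * ?n ^ card VH"
    using 1 by linarith
  then show ?thesis
    using opt clique_free_colouring[OF col] rel_graph_colouring[of c] unfolding near_opt_def by (smt (verit))
qed

end

section \<open>Sizes of the colour classes\<close>

lemma exists_balanced_colouring:
  assumes "finite V" "0 < k"
  shows "\<exists>c. (\<forall>y\<in>V. c y < k) \<and> (\<forall>i<k. card V div k \<le> card {y \<in> V. c y = i})"
proof -
  obtain f where f: "bij_betw f V {0..<card V}"
    using ex_bij_betw_finite_nat[OF assms(1)] by blast
  have "card V div k \<le> card {y \<in> V. f y mod k = i}" if "i < k" for i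
  proof -
    have "(\<lambda>j. j * k + i) ` {..<card V div k} \<subseteq> f ` {y \<in> V. f y mod k = i}"
    proof
      fix m assume "m \<in> (\<lambda>j. j * k + i) ` {..<card V div k}"
      then obtain j where j: "j < card V div k" "m = j * k + i" by auto
      have "Suc j * k \<le> card V div k * k" using j(1) by (intro mult_right_mono) auto
      also have "\<dots> \<le> card V" by simp
      finally have "m < card V" using j(2) that by simp
      moreover have "m mod k = i" using j(2) that by simp
      ultimately show "m \<in> f ` {y \<in> V. f y mod k = i}"
        using f by (force simp: bij_betw_def)
    qed
    then have "card ((\<lambda>j. j * k + i) ` {..<card V div k}) \<le> card (f ` {y \<in> V. f y mod k = i})"
      using assms(1) by (intro card_mono) auto
    also have "\<dots> \<le> card {y \<in> V. f y mod k = i}" using assms(1) by (intro card_image_le) auto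
    finally show ?thesis using assms(2) by (simp add: card_image inj_on_def)
  qed
  then show ?thesis using assms(2) by (intro exI[of _ "\<lambda>y. f y mod k"]) auto
qed

context multipartite_pattern
begin

lemma card_Pi_ge:
  fixes W :: "'a \<Rightarrow> 'b set" and x :: real
  assumes "0 \<le> x" "\<And>v. v \<in> VH \<Longrightarrow> x \<le> real (card (W v))"
  shows "x ^ card VH \<le> real (card (Pi\<^sub>E VH W))"
proof -
  have "(\<Prod>v\<in>VH. x) \<le> (\<Prod>v\<in>VH. real (card (W v)))" using assms by (intro prod_mono) auto
  then show ?thesis using finVH by (simp add: card_PiE)
qed

lemma real_card_hits_set:
  assumes "finite V" "S \<subseteq> V" "real (card S) \<le> x * real (card V)"
  shows "real (card {\<phi> \<in> VH \<rightarrow>\<^sub>E V. \<exists>u\<in>VH. \<phi> u \<in> S}) \<le> real (card VH) * x * real (card V) ^ card VH"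
proof -
  have "real (card {\<phi> \<in> VH \<rightarrow>\<^sub>E V. \<exists>u\<in>VH. \<phi> u \<in> S}) \<le> real (card VH * (card S * card V ^ (card VH - 1)))"
    using card_PiE_hits_set[OF finVH assms(1,2)] by (simp only: of_nat_le_iff)
  also have "\<dots> = real (card VH) * (real (card S) * real (card V) ^ (card VH - 1))" by simp
  also have "\<dots> \<le> real (card VH) * ((x * real (card V)) * real (card V) ^ (card VH - 1))"
    using assms(3) by (intro mult_left_mono mult_right_mono) auto
  also have "\<dots> = real (card VH) * x * (real (card V) * real (card V) ^ (card VH - 1))" by simp
  also have "real (card V) * real (card V) ^ (card VH - 1) = real (card V) ^ card VH"
    using card_VH_ge2 by (metis Suc_diff_1 less_le_trans pos2 power_Suc)
  finally show ?thesis .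
qed

text \<open>The competitor is a balanced complete \<open>k\<close>-partite graph, admissible because
  \<open>k \<le> r\<close>; the maps sending each part of \<open>H\<close> into its own class
  suffice. The factor 2 absorbs the rounding in \<open>card V div k\<close>.\<close>

lemma near_opt_card_homs_ge:
  assumes opt: "near_opt r V A d" and fin: "finite V" and kr: "k \<le> r" and big: "2 * k \<le> card V"
  shows "(real (card V) / (2 * real k)) ^ card VH \<le> real (card (homs V A)) + d"
proof -
  have k0: "0 < k" using k2 by simp
  obtain c where c: "\<forall>y\<in>V. c y < k" "\<forall>i<k. card V div k \<le> card {y \<in> V. c y = i}"
    using exists_balanced_colouring[OF fin k0] by blast
  let ?W = "\<lambda>v. {y \<in> V. c y = cH v}"
  have ck: "cH v < k" if "v \<in> VH" for v using parts that by auto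
  have "real (card V) / (2 * real k) \<le> real (card V div k)"
  proof -
    have "card V < (card V div k + 1) * k"
      using k0 by (metis add.commute dividend_less_div_times mult.commute plus_1_eq_Suc mult_Suc)
    then have "real (card V) \<le> real ((card V div k + 1) * k)" by (simp only: of_nat_le_iff)
    then have "real (card V) \<le> (real (card V div k) + 1) * real k" by (simp add: distrib_right)
    moreover have "1 \<le> card V div k" using big k0 by (simp add: div_greater_zero_iff Suc_le_eq)
    then have "(real (card V div k) + 1) * real k \<le> (2 * real (card V div k)) * real k"
      by (intro mult_right_mono) auto
    ultimately have "real (card V) \<le> real (card V div k) * (2 * real k)" by linarith
    then show ?thesis using k0 by (simp add: divide_le_eq)
  qed
  then have lower: "(real (card V) / (2 * real k)) ^ card VH \<le> real (card (Pi\<^sub>E VH ?W))"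
    using c(2) ck by (intro card_Pi_ge) (auto intro: order_trans)
  have "Pi\<^sub>E VH ?W \<subseteq> homs V (\<lambda>x y. c x \<noteq> c y)"
  proof
    fix \<phi> assume \<phi>: "\<phi> \<in> Pi\<^sub>E VH ?W"
    then have "c (\<phi> v) = cH v" "\<phi> v \<in> V" if "v \<in> VH" for v using that by (auto dest: PiE_mem)
    then show "\<phi> \<in> homs V (\<lambda>x y. c x \<noteq> c y)"
      using \<phi> by (auto simp: homs_def ishom_def PiE_iff)
  qed
  then have middle: "real (card (Pi\<^sub>E VH ?W)) \<le> real (card (homs V (\<lambda>x y. c x \<noteq> c y)))"
    using finite_homs[OF fin] by (simp add: card_mono)
  have "\<forall>y\<in>V. c y < r" using c(1) kr by auto
  then have "real (card (homs V (\<lambda>x y. c x \<noteq> c y))) \<le> real (card (homs V A)) + d"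
    using opt clique_free_colouring[of V c r] rel_graph_colouring[of c] unfolding near_opt_def by blast
  then show ?thesis using lower middle by linarith
qed

text \<open>A homomorphism into the multipartite graph uses at least \<open>k\<close> colours, since
  different parts of \<open>H\<close> never share one. With fewer than \<open>k\<close> large
  classes it must touch a small one, and all small classes together are too few vertices for the
  assumed count.\<close>

lemma many_large_classes:
  fixes x :: real
  assumes fin: "finite V" and col: "\<forall>y\<in>V. c y < r" and x: "0 \<le> x"
    and homs: "real (card VH) * (real r * x) * real (card V) ^ card VH < real (card (homs V (\<lambda>y z. c y \<noteq> c z)))"
  shows "k \<le> card {i. i < r \<and> x * real (card V) \<le> real (card {y \<in> V. c y = i})}"
proof (rule ccontr)
  let ?n = "real (card V)"
  let ?T = "\<lambda>y z. c y \<noteq> c z"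
  define L where "L = {i. i < r \<and> x * ?n \<le> real (card {y \<in> V. c y = i})}"
  assume "\<not> ?thesis"
  then have L: "card L < k" by (simp add: L_def)
  have finL: "finite L" by (simp add: L_def)
  let ?S = "{y \<in> V. c y \<notin> L}"
  have "homs V ?T \<subseteq> {\<phi> \<in> VH \<rightarrow>\<^sub>E V. \<exists>u\<in>VH. \<phi> u \<in> ?S}"
  proof
    fix \<phi> assume \<phi>: "\<phi> \<in> homs V ?T"
    have "\<exists>u\<in>VH. \<phi> u \<in> ?S"
    proof (rule ccontr)
      assume none: "\<not> ?thesis"
      have inV: "\<phi> u \<in> V" if "u \<in> VH" for u using \<phi> that by (auto simp: homs_def)
      have "\<forall>i\<in>{0..<k}. \<exists>u\<in>VH. cH u = i" using parts by (metis imageE)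
      then obtain g where g: "\<And>i. i < k \<Longrightarrow> g i \<in> VH \<and> cH (g i) = i"
        unfolding Ball_def by (metis atLeastLessThan_iff zero_le)
      have "inj_on (\<lambda>i. c (\<phi> (g i))) {..<k}"
      proof (rule inj_onI, rule ccontr)
        fix i j assume "i \<in> {..<k}" "j \<in> {..<k}" "c (\<phi> (g i)) = c (\<phi> (g j))" "i \<noteq> j"
        then show False using \<phi> g[of i] g[of j] by (auto simp: homs_def ishom_def)
      qed
      moreover have "(\<lambda>i. c (\<phi> (g i))) ` {..<k} \<subseteq> L" using g none inV by auto
      ultimately have "card {..<k} \<le> card L" using finL by (rule card_inj_on_le)
      then show False using L by simp
    qed
    then show "\<phi> \<in> {\<phi> \<in> VH \<rightarrow>\<^sub>E V. \<exists>u\<in>VH. \<phi> u \<in> ?S}" using \<phi> by (simp add: homs_def)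
  qed
  then have "real (card (homs V ?T)) \<le> real (card {\<phi> \<in> VH \<rightarrow>\<^sub>E V. \<exists>u\<in>VH. \<phi> u \<in> ?S})"
    using finite_maps[OF fin] by (simp add: card_mono)
  also have "\<dots> \<le> real (card VH) * (real r * x) * ?n ^ card VH"
  proof (rule real_card_hits_set[OF fin])
    have "?S \<subseteq> (\<Union>i\<in>{..<r} - L. {y \<in> V. c y = i})" using col by auto
    then have "card ?S \<le> card (\<Union>i\<in>{..<r} - L. {y \<in> V. c y = i})"
      using fin by (intro card_mono) auto
    also have "\<dots> \<le> (\<Sum>i\<in>{..<r} - L. card {y \<in> V. c y = i})" by (rule card_UN_le) simp
    finally have "real (card ?S) \<le> (\<Sum>i\<in>{..<r} - L. real (card {y \<in> V. c y = i}))"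
      by (simp flip: of_nat_sum)
    also have "\<dots> \<le> real (card ({..<r} - L)) * (x * ?n)"
      by (rule sum_bounded_above) (auto simp: L_def)
    also have "\<dots> \<le> real r * (x * ?n)"
    proof (rule mult_right_mono)
      have "card ({..<r} - L) \<le> card {..<r}" by (intro card_mono) auto
      then show "real (card ({..<r} - L)) \<le> real r" by simp
    qed (use x in simp)
    finally show "real (card ?S) \<le> real r * x * ?n" by simp
  qed auto
  finally show False using homs by linarith
qed

text \<open>Recolouring half of a large class with the colour of a negligible class creates many new
  copies and destroys few.\<close>

lemma near_opt_colouring_classes_large:
  fixes r :: nat
  assumes kr: "k \<le> r"
  shows "\<exists>c0 d n0. 0 < c0 \<and> 0 < d \<and> (\<forall>(V :: 'b set) c. finite V \<and> n0 \<le> card V \<and> (\<forall>y\<in>V. c y < r)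
    \<and> near_opt r V (\<lambda>x y. c x \<noteq> c y) (d * real (card V) ^ card VH)
    \<longrightarrow> (\<forall>i<r. c0 * real (card V) \<le> real (card {y \<in> V. c y = i})))"
proof -
  let ?h = "real (card VH)"
  have h1: "?h \<ge> 1" using card_VH_ge2 by simp
  have r0: "real r > 0" "real k > 0" using kr k2 by auto
  define m where "m = (1 / (2 * real k)) ^ card VH"
  have m0: "m > 0" using r0 by (simp add: m_def)
  \<comment> \<open>\<open>m\<close> is the density of homomorphisms of the balanced competitor.
    With this \<open>c1\<close>, homomorphisms forced to touch classes below \<open>c1 * n\<close>
    would have density at most \<open>m / 4\<close>, whereas \<open>d \<le> m / 2\<close> guarantees
    \<open>m / 2\<close>.\<close>
  define c1 where "c1 = m / (4 * ?h * real r)"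
  have c1: "c1 > 0" using m0 h1 r0 by (simp add: c1_def)
  have c1_eq: "?h * (real r * c1) = m / 4" using h1 r0 by (simp add: c1_def)
  \<comment> \<open>A lower bound for the density of new copies: half of a class of size
    \<open>c1 * n\<close> still has \<open>c1 / 4 * n\<close> vertices after rounding, once
    \<open>4 \<le> c1 * n\<close>.\<close>
  define g where "g = (c1 / 4) ^ card VH"
  have g0: "g > 0" using c1 by (simp add: g_def)
  \<comment> \<open>Copies destroyed by the recolouring meet the negligible class, so their density
    is at most \<open>g / 4\<close>; with \<open>d \<le> g / 4\<close> the gain \<open>g\<close>
    wins. The bound by \<open>c1\<close> keeps the negligible class apart from the large
    ones.\<close>
  define c0 where "c0 = min c1 (g / (4 * ?h))"
  have c0: "c0 > 0" "c0 \<le> c1" "?h * c0 \<le> g / 4"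
    using c1 g0 h1 by (auto simp: c0_def min_def field_simps)
  define d where "d = min (m / 2) (g / 4)"
  have d: "d > 0" "d \<le> m / 2" "d \<le> g / 4" using m0 g0 by (auto simp: d_def)
  define n0 where "n0 = 2 * k + nat \<lceil>4 / c1\<rceil> + 1"
  have main: "c0 * n \<le> real (card {y \<in> V. c y = j})"
    if fin: "finite V" and big: "n0 \<le> card V" and n_def: "n = real (card V)"
      and col: "\<forall>y\<in>V. c y < r" and opt: "near_opt r V (\<lambda>x y. c x \<noteq> c y) (d * n ^ card VH)" and j: "j < r"
    for V :: "'b set" and c n j
  proof (rule ccontr)
    assume small: "\<not> ?thesis"
    let ?T = "\<lambda>x y. c x \<noteq> c y"
    let ?C = "\<lambda>i. {y \<in> V. c y = i}"
    let ?N = "n ^ card VH"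
    have n_pos: "n > 0" using big by (simp add: n_def n0_def)
    have N_pos: "?N > 0" using n_pos by simp
    have n4: "4 \<le> c1 * n"
    proof -
      have "4 / c1 \<le> n" using big unfolding n0_def n_def by linarith
      then show ?thesis using c1 by (simp add: field_simps)
    qed
    have "m * ?N \<le> real (card (homs V ?T)) + d * ?N"
      using near_opt_card_homs_ge[OF opt fin kr] big
      by (simp add: n0_def m_def n_def flip: power_mult_distrib)
    moreover have "d * ?N \<le> m / 2 * ?N" using d(2) N_pos by (intro mult_right_mono) auto
    ultimately have "m / 2 * ?N \<le> real (card (homs V ?T))" by linarith
    moreover have "m / 4 * ?N < m / 2 * ?N" using m0 N_pos by simp
    ultimately have "?h * (real r * c1) * ?N < real (card (homs V ?T))" unfolding c1_eq by linarith
    then have "k \<le> card {i. i < r \<and> c1 * n \<le> real (card (?C i))}"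
      using many_large_classes[OF fin col, of c1] c1 by (simp add: n_def)
    then obtain L where L: "L \<subseteq> {i. i < r \<and> c1 * n \<le> real (card (?C i))}" "card L = k"
      using obtain_subset_with_card_n by (metis (lifting))
    have finL: "finite L" using L(2) k2 by (metis card.infinite not_numeral_le_zero)
    obtain \<sigma> where \<sigma>: "bij_betw \<sigma> {0..<k} L"
      using ex_bij_betw_nat_finite[OF finL] L(2) by auto
    have \<sigma>L: "\<sigma> p < r" "c1 * n \<le> real (card (?C (\<sigma> p)))" if "p < k" for p
    proof -
      have "\<sigma> p \<in> L" using bij_betwE[OF \<sigma>] that by simp
      then show "\<sigma> p < r" "c1 * n \<le> real (card (?C (\<sigma> p)))" using L(1) by auto
    qed
    have \<sigma>_inj: "\<sigma> p \<noteq> \<sigma> q" if "p < k" "q < k" "p \<noteq> q" for p q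
      using \<sigma> that by (auto simp: bij_betw_def inj_on_def)
    have "c0 * n \<le> c1 * n" using c0(2) n_pos by (intro mult_right_mono) auto
    then have j\<sigma>: "\<sigma> p \<noteq> j" if "p < k" for p
      using \<sigma>L(2)[OF that] small by auto
    define i where "i = \<sigma> 0"
    have k_pos: "0 < k" "1 < k" using k2 by auto
    obtain X where X: "X \<subseteq> ?C i" "card X = card (?C i) div 2"
      by (meson div_le_dividend obtain_subset_with_card_n)
    have finX: "finite X" using X(1) fin by (auto intro: finite_subset)
    have Ci: "c1 * n \<le> real (card (?C i))" using \<sigma>L k_pos by (simp add: i_def)
    have "real (card X) \<ge> real (card (?C i)) / 2 - 1"
      unfolding X(2) by linarith
    then have cX: "c1 / 4 * n \<le> real (card X)" using Ci n4 by linarith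
    have "card (?C i - X) = card (?C i) - card X" using X(1) finX by (simp add: card_Diff_subset)
    then have "real (card (?C i - X)) \<ge> real (card (?C i)) / 2" using X(2) by linarith
    then have cX': "c1 / 4 * n \<le> real (card (?C i - X))" using Ci n4 by linarith
    define c' where "c' y = (if y \<in> X then j else c y)" for y
    let ?T' = "\<lambda>x y. c' x \<noteq> c' y"
    \<comment> \<open>Parts 0 and 1 of \<open>H\<close> go to the two halves of class
      \<open>i\<close>, which makes these maps new, and the other parts to the remaining large
      classes. \<open>\<tau>\<close> below records the colours of the parts after
      recolouring.\<close>
    define W where "W v = (if cH v = 0 then ?C i - X else if cH v = 1 then X else ?C (\<sigma> (cH v)))" for v
    have ck: "cH v < k" if "v \<in> VH" for v using parts that by auto
    have cW: "c1 / 4 * n \<le> real (card (W v))" if "v \<in> VH" for v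
    proof -
      have "c1 / 4 * n \<le> c1 * n" using c1 n_pos by simp
      then show ?thesis using cX cX' \<sigma>L(2)[OF ck[OF that]] by (auto simp: W_def)
    qed
    have "g * ?N = (c1 / 4 * n) ^ card VH" unfolding g_def power_mult_distrib ..
    also have "\<dots> \<le> real (card (Pi\<^sub>E VH W))"
      using cW c1 n_pos by (intro card_Pi_ge) auto
    finally have gain: "g * ?N \<le> real (card (Pi\<^sub>E VH W))" .
    define \<tau> where "\<tau> p = (if p = 0 then i else if p = 1 then j else \<sigma> p)" for p
    have \<tau>_inj: "\<tau> p \<noteq> \<tau> q" if "p < k" "q < k" "p \<noteq> q" for p q
      using that \<sigma>_inj[of p q] \<sigma>_inj[of 0 p] \<sigma>_inj[of 0 q] j\<sigma>[of p] j\<sigma>[of q] j\<sigma>[of 0] k_pos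
      by (auto simp: \<tau>_def i_def)
    have W_c: "\<phi> v \<in> V \<and> c' (\<phi> v) = \<tau> (cH v)"
      if "\<phi> \<in> Pi\<^sub>E VH W" "v \<in> VH" for \<phi> v
    proof -
      have "\<phi> v \<in> W v" using that by (auto dest: PiE_mem)
      moreover have "\<sigma> (cH v) \<noteq> i" if "cH v \<noteq> 0"
        using \<sigma>_inj[of "cH v" 0] ck[OF \<open>v \<in> VH\<close>] k_pos that by (simp add: i_def)
      ultimately show ?thesis using X(1) by (auto simp: W_def c'_def \<tau>_def split: if_splits)
    qed
    have sub1: "Pi\<^sub>E VH W \<subseteq> homs V ?T'"
    proof
      fix \<phi> assume \<phi>: "\<phi> \<in> Pi\<^sub>E VH W"
      have "c' (\<phi> u) \<noteq> c' (\<phi> v)" if "u \<in> VH" "v \<in> VH" "cH u \<noteq> cH v" for u v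
        using W_c[OF \<phi> that(1)] W_c[OF \<phi> that(2)] \<tau>_inj[OF ck ck that(3)] that by simp
      then show "\<phi> \<in> homs V ?T'"
        using \<phi> W_c[OF \<phi>] by (auto simp: homs_def ishom_def PiE_iff)
    qed
    have disj: "Pi\<^sub>E VH W \<inter> homs V ?T = {}"
    proof -
      have "0 \<in> cH ` VH" "1 \<in> cH ` VH" using parts k_pos by auto
      then obtain u v where uv: "u \<in> VH" "cH u = 0" "v \<in> VH" "cH v = 1" by force
      have "\<phi> \<notin> homs V ?T" if "\<phi> \<in> Pi\<^sub>E VH W" for \<phi>
      proof -
        have "\<phi> u \<in> W u" "\<phi> v \<in> W v" using that uv by (auto dest: PiE_mem)
        then have "c (\<phi> u) = i" "c (\<phi> v) = i" using uv X(1) by (auto simp: W_def)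
        then have "c (\<phi> u) = c (\<phi> v)" "cH u \<noteq> cH v" using uv by auto
        then show ?thesis using uv(1,3) unfolding homs_def ishom_def by blast
      qed
      then show ?thesis by blast
    qed
    let ?J = "{\<phi> \<in> VH \<rightarrow>\<^sub>E V. \<exists>u\<in>VH. \<phi> u \<in> ?C j}"
    have sub2: "homs V ?T - ?J \<subseteq> homs V ?T'"
    proof
      fix \<phi> assume \<phi>: "\<phi> \<in> homs V ?T - ?J"
      then have maps: "\<phi> \<in> VH \<rightarrow>\<^sub>E V" by (simp add: homs_def)
      have nj: "c (\<phi> u) \<noteq> j" if "u \<in> VH" for u
        using \<phi> maps that by (auto dest: PiE_mem)
      have "c' (\<phi> u) \<noteq> c' (\<phi> v)" if "u \<in> VH" "v \<in> VH" "cH u \<noteq> cH v" for u v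
      proof -
        have "c (\<phi> u) \<noteq> c (\<phi> v)" using \<phi> that by (auto simp: homs_def ishom_def)
        then show ?thesis using nj[OF that(1)] nj[OF that(2)] X(1) by (auto simp: c'_def)
      qed
      then show "\<phi> \<in> homs V ?T'" using maps by (auto simp: homs_def ishom_def)
    qed
    have "card (Pi\<^sub>E VH W) + card (homs V ?T - ?J) = card (Pi\<^sub>E VH W \<union> (homs V ?T - ?J))"
      using disj finite_homs[OF fin] finite_subset[OF sub1 finite_homs[OF fin]]
      by (intro card_Un_disjoint[symmetric]) auto
    also have "\<dots> \<le> card (homs V ?T')"
      using sub1 sub2 finite_homs[OF fin] by (intro card_mono) auto
    finally have 1: "card (Pi\<^sub>E VH W) + card (homs V ?T - ?J) \<le> card (homs V ?T')" .
    have 2: "card (homs V ?T) \<le> card (homs V ?T - ?J) + card ?J"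
      using diff_card_le_card_Diff[of ?J "homs V ?T"] finite_maps[OF fin] by simp
    have "real (card ?J) \<le> ?h * c0 * ?N"
      using real_card_hits_set[OF fin, of "?C j" c0] small by (simp add: n_def)
    also have "\<dots> \<le> g / 4 * ?N" using c0(3) N_pos by (intro mult_right_mono) auto
    finally have 3: "real (card ?J) \<le> g / 4 * ?N" .
    have "\<forall>y\<in>V. c' y < r" using col j by (simp add: c'_def)
    then have "real (card (homs V ?T')) \<le> real (card (homs V ?T)) + d * ?N"
      using opt clique_free_colouring[of V c' r] rel_graph_colouring[of c'] unfolding near_opt_def by blast
    moreover have "d * ?N \<le> g / 4 * ?N" using d(3) N_pos by (intro mult_right_mono) auto
    ultimately have "real (card (homs V ?T')) \<le> real (card (homs V ?T)) + g / 4 * ?N" by linarith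
    moreover have "real (card (Pi\<^sub>E VH W)) + real (card (homs V ?T - ?J)) \<le> real (card (homs V ?T'))"
      "real (card (homs V ?T)) \<le> real (card (homs V ?T - ?J)) + real (card ?J)"
      using 1 2 by linarith+
    ultimately have "g * ?N \<le> g / 4 * ?N + g / 4 * ?N" using gain 3 by linarith
    then show False using g0 N_pos by simp
  qed
  show ?thesis
    by (rule exI[of _ c0], rule exI[of _ d], rule exI[of _ n0]) (use c0 d main in blast)
qed

text \<open>The colouring comes from a thinned graph \<open>A'\<close> but must fit
  \<open>A\<close>. Missing edges across the classes can only become fewer, as \<open>A'\<close> is
  contained in \<open>A\<close>. Edges inside the classes may include deleted ones and are bounded
  through the sizes of the classes, which follow from near-optimality of the multipartite graph. The
  same sizes show that every colour occurs.\<close>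

theorem near_opt_close_to_colouring:
  fixes \<epsilon> :: real and r :: nat
  assumes kr: "k \<le> r" and \<epsilon>: "0 < \<epsilon>"
  shows "\<exists>\<delta> n0. 0 < \<delta> \<and> (\<forall>(V :: 'b set) A. finite V \<and> n0 \<le> card V \<and> near_opt r V A (\<delta> * real (card V) ^ card VH)
    \<longrightarrow> (\<exists>c. c ` V = {0..<r} \<and> real (card (colour_errors V A c)) \<le> \<epsilon> * real (card V) ^ 2))"
proof -
  let ?h = "real (card VH)"
  have h1: "?h \<ge> 1" using card_VH_ge2 by simp
  have r0: "real r > 0" using kr k2 by simp
  obtain c0 d n1 where c0: "0 < c0" "0 < d" and large: "\<forall>(V :: 'b set) c. finite V \<and> n1 \<le> card V \<and>
      (\<forall>y\<in>V. c y < r) \<and> near_opt r V (\<lambda>x y. c x \<noteq> c y) (d * real (card V) ^ card VH)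
      \<longrightarrow> (\<forall>i<r. c0 * real (card V) \<le> real (card {y \<in> V. c y = i}))"
    using near_opt_colouring_classes_large[OF kr] by (elim exE conjE)
  \<comment> \<open>Of the class density \<open>c0\<close>, half is reserved for the non-neighbours
    of the greedy clique and, through \<open>e\<close>, at most a quarter for the exceptional
    vertices.\<close>
  define \<theta> where "\<theta> = c0 / (2 * real (r + 1))"
  have \<theta>: "0 < \<theta>" "real (r + 1) * \<theta> = c0 / 2" using c0 by (auto simp: \<theta>_def field_simps)
  \<comment> \<open>The four bounds serve, in order, the greedy clique, the edges inside the
    classes, the missing edges across them, and near-optimality of the multipartite graph.\<close>
  define e where "e = min (\<theta> * c0 / 4) (min (\<epsilon> * \<theta> / 4) (min (\<epsilon> / 2) (d / (2 * ?h\<^sup>2))))"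
  have e: "0 < e" "e \<le> \<theta> * c0 / 4" "e \<le> \<epsilon> * \<theta> / 4" "e \<le> \<epsilon> / 2" "e \<le> d / (2 * ?h\<^sup>2)"
    using c0 \<epsilon> \<theta> h1 by (auto simp: e_def)
  have "e / \<theta> \<le> c0 / 4" "e / \<theta> \<le> \<epsilon> / 4"
    using e(2,3) \<theta>(1) by (simp_all add: pos_divide_le_eq mult_ac)
  then have e\<theta>: "e / \<theta> \<le> c0 / 4" "2 * (e / \<theta>) \<le> \<epsilon> / 2" by linarith+
  \<comment> \<open>Tuned to \<open>colouring_of_few_bad_triples\<close> with
    \<open>\<gamma> = e / 2\<close>: both terms of its bound become
    \<open>e / 2 * n\<^sup>2\<close>.\<close>
  define \<beta> where "\<beta> = e * (e / 2) / (6 * real r)"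
  have \<beta>: "0 < \<beta>" using e r0 by (simp add: \<beta>_def)
  obtain \<delta> n2 where \<delta>: "0 < \<delta>" and reg: "\<forall>(V :: 'b set) A. finite V \<and> n2 \<le> card V \<and>
      near_opt r V A (\<delta> * real (card V) ^ card VH) \<longrightarrow>
      (\<exists>A'. (\<forall>x y. A' x y \<longrightarrow> A x y) \<and> near_opt r V A' (d / 2 * real (card V) ^ card VH)
        \<and> real (card (bad_triples V A')) \<le> \<beta> * real (card V) ^ 3)"
    using near_opt_few_bad_triples[where r = r, OF \<beta> half_gt_zero[OF c0(2)]] by (elim exE conjE)
  have main: "\<exists>c. c ` V = {0..<r} \<and> real (card (colour_errors V A c)) \<le> \<epsilon> * n\<^sup>2"
    if fin: "finite V" and big: "n1 + n2 + 1 \<le> card V" and n_def: "n = real (card V)"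
      and opt: "near_opt r V A (\<delta> * n ^ card VH)" for V :: "'b set" and A n
  proof -
    have n_pos: "n > 0" using big by (simp add: n_def)
    obtain A' where A': "\<And>x y. A' x y \<Longrightarrow> A x y" "near_opt r V A' (d / 2 * n ^ card VH)"
      "real (card (bad_triples V A')) \<le> \<beta> * n ^ 3"
      using reg[rule_format, of V A] fin big opt by (auto simp: n_def)
    have gA: "rel_graph A" "clique_free r V A" and gA': "rel_graph A'" "clique_free r V A'"
      using opt A'(2) by (auto simp: near_opt_def)
    obtain c where col: "\<forall>y\<in>V. c y < r"
      and raw: "real (card (colour_errors V A' c)) \<le> real r * (3 * \<beta> / (e / 2) * n\<^sup>2) + e / 2 * n\<^sup>2"
      using colouring_of_few_bad_triples[OF gA'(1) fin, of "e / 2" \<beta> V r] e(1) \<beta> gA'(2) A'(3)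
      by (auto simp: n_def)
    have eq: "real r * (3 * \<beta> / (e / 2) * n\<^sup>2) = e / 2 * n\<^sup>2"
      using e(1) r0 by (simp add: \<beta>_def field_simps)
    have err: "real (card (colour_errors V A' c)) \<le> e * n\<^sup>2" using raw unfolding eq by simp
    have "near_opt r V (\<lambda>x y. c x \<noteq> c y) (d / 2 * n ^ card VH + ?h\<^sup>2 * e * n ^ card VH)"
      using near_opt_colouring[OF A'(2) fin col] err by (simp add: n_def)
    moreover have "?h\<^sup>2 * e \<le> d / 2" using e(5) h1 by (simp add: field_simps)
    then have "?h\<^sup>2 * e * n ^ card VH \<le> d / 2 * n ^ card VH"
      using n_pos by (intro mult_right_mono) auto
    ultimately have optT: "near_opt r V (\<lambda>x y. c x \<noteq> c y) (d * n ^ card VH)"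
      by (elim near_opt_mono) simp
    have lg: "\<forall>i<r. c0 * n \<le> real (card {y \<in> V. c y = i})"
      using large[rule_format, of V c] fin col optT big by (simp add: n_def)
    have onto: "c ` V = {0..<r}"
    proof
      show "{0..<r} \<subseteq> c ` V"
      proof
        fix i assume "i \<in> {0..<r}"
        then have "c0 * n \<le> real (card {y \<in> V. c y = i})" using lg by simp
        moreover have "c0 * n > 0" using c0 n_pos by simp
        ultimately have "{y \<in> V. c y = i} \<noteq> {}" by (metis card.empty not_less of_nat_0)
        then show "i \<in> c ` V" by auto
      qed
    qed (use col in auto)
    let ?X = "{(y, z). y \<in> V \<and> z \<in> V \<and> c y \<noteq> c z \<and> \<not> A y z}"
    let ?I = "{(y, z). y \<in> V \<and> z \<in> V \<and> c y = c z \<and> A y z}"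
    have "?X \<subseteq> colour_errors V A' c" using A'(1) by (auto simp: colour_errors_def)
    then have "card ?X \<le> card (colour_errors V A' c)"
      using finite_colour_errors[OF fin] by (intro card_mono)
    then have X: "real (card ?X) \<le> e * n\<^sup>2" using err by linarith
    have "real (r + 1) * \<theta> + e / \<theta> < c0" using \<theta>(2) e\<theta>(1) c0(1) by linarith
    then have "real (card ?I) \<le> 2 * (e / \<theta>) * n\<^sup>2"
      using few_edges_inside_classes[OF gA fin col _ \<theta>(1)] lg X unfolding n_def by blast
    also have "\<dots> \<le> \<epsilon> / 2 * n\<^sup>2" using e\<theta> by (intro mult_right_mono) auto
    finally have I: "real (card ?I) \<le> \<epsilon> / 2 * n\<^sup>2" .
    have "colour_errors V A c = ?X \<union> ?I" by (auto simp: colour_errors_def)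
    then have "card (colour_errors V A c) \<le> card ?X + card ?I" by (simp add: card_Un_le)
    moreover have "e * n\<^sup>2 \<le> \<epsilon> / 2 * n\<^sup>2" using e(4) by (intro mult_right_mono) auto
    ultimately have "real (card (colour_errors V A c)) \<le> \<epsilon> * n\<^sup>2" using X I by linarith
    then show ?thesis using onto by blast
  qed
  show ?thesis
    by (rule exI[of _ \<delta>], rule exI[of _ "n1 + n2 + 1"]) (use \<delta> main in blast)
qed

end

section \<open>Copies and injective homomorphisms\<close>

definition edge_rel :: "'b set set \<Rightarrow> 'b \<Rightarrow> 'b \<Rightarrow> bool" where
  "edge_rel E x y \<longleftrightarrow> {x, y} \<in> E"

definition edges_of :: "'b set \<Rightarrow> ('b \<Rightarrow> 'b \<Rightarrow> bool) \<Rightarrow> 'b set set" where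
  "edges_of V A = {{x, y} | x y. x \<in> V \<and> y \<in> V \<and> A x y}"

definition copies :: "'a set \<Rightarrow> 'a set set \<Rightarrow> 'b set \<Rightarrow> 'b set set \<Rightarrow> ('b set \<times> 'b set set) set" where
  "copies VH EH V E = {(V', E'). V' \<subseteq> V \<and> E' \<subseteq> E \<and> graph_iso VH EH V' E'}"

definition inj_maps :: "'a set \<Rightarrow> 'a set set \<Rightarrow> 'b set \<Rightarrow> 'b set set \<Rightarrow> ('a \<Rightarrow> 'b) set" where
  "inj_maps VH EH V E = {\<phi> \<in> VH \<rightarrow>\<^sub>E V. inj_on \<phi> VH \<and> (\<forall>e\<in>EH. \<phi> ` e \<in> E)}"

definition automorphisms :: "'a set \<Rightarrow> 'a set set \<Rightarrow> ('a \<Rightarrow> 'a) set" where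
  "automorphisms VH EH = {\<pi> \<in> VH \<rightarrow>\<^sub>E VH. bij_betw \<pi> VH VH \<and> (`) \<pi> ` EH = EH}"

lemma simple_graph_subset_Pow: "simple_graph V E \<Longrightarrow> E \<subseteq> Pow V"
  by (auto simp: simple_graph_def)

lemma finite_copies:
  assumes "finite V" "E \<subseteq> Pow V"
  shows "finite (copies VH EH V E)"
proof (rule finite_subset)
  show "copies VH EH V E \<subseteq> Pow V \<times> Pow (Pow V)"
    using assms(2) by (auto simp: copies_def)
qed (use assms in simp)

text \<open>Fixing one isomorphism \<open>f\<close> onto the copy, composition with \<open>f\<close>
  is a bijection from the automorphisms to the embeddings with that image. Maps are restricted to
  \<open>VH\<close> so that equal ones are counted once.\<close>

lemma card_inj_maps_onto_copy:
  assumes EH: "EH \<subseteq> Pow VH" and copy: "(V', E') \<in> copies VH EH V E"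
  shows "card {\<phi> \<in> inj_maps VH EH V E. (\<phi> ` VH, (`) \<phi> ` EH) = (V', E')} = card (automorphisms VH EH)"
proof -
  let ?F = "{\<phi> \<in> inj_maps VH EH V E. (\<phi> ` VH, (`) \<phi> ` EH) = (V', E')}"
  obtain f where f: "bij_betw f VH V'" "E' = (`) f ` EH"
    and sub: "V' \<subseteq> V" "E' \<subseteq> E"
    using copy by (auto simp: copies_def graph_iso_def)
  have injf: "inj_on f VH" and imgf: "f ` VH = V'" using f(1) by (auto simp: bij_betw_def)
  let ?g = "inv_into VH f"
  have g: "bij_betw ?g V' VH" using f(1) by (rule bij_betw_inv_into)
  have img: "(`) (restrict (p \<circ> q) VH) ` EH = (`) p ` ((`) q ` EH)" for p :: "'c \<Rightarrow> 'd" and q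
  proof -
    have "restrict (p \<circ> q) VH ` e = p ` (q ` e)" if "e \<in> EH" for e
      using that EH by (auto simp: image_comp intro!: image_cong)
    then show ?thesis by (auto simp: image_image)
  qed
  have "bij_betw (\<lambda>\<pi>. restrict (f \<circ> \<pi>) VH) (automorphisms VH EH) ?F"
  proof (rule bij_betw_byWitness[where f' = "\<lambda>\<phi>. restrict (?g \<circ> \<phi>) VH"])
    show "\<forall>\<pi>\<in>automorphisms VH EH. restrict (?g \<circ> restrict (f \<circ> \<pi>) VH) VH = \<pi>"
    proof
      fix \<pi> assume "\<pi> \<in> automorphisms VH EH"
      then have \<pi>: "\<pi> \<in> VH \<rightarrow>\<^sub>E VH" by (simp add: automorphisms_def)
      show "restrict (?g \<circ> restrict (f \<circ> \<pi>) VH) VH = \<pi>"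
      proof
        fix v show "restrict (?g \<circ> restrict (f \<circ> \<pi>) VH) VH v = \<pi> v"
          using \<pi> injf by (cases "v \<in> VH") (auto simp: PiE_iff extensional_def)
      qed
    qed
    show "\<forall>\<phi>\<in>?F. restrict (f \<circ> restrict (?g \<circ> \<phi>) VH) VH = \<phi>"
    proof
      fix \<phi> assume \<phi>: "\<phi> \<in> ?F"
      show "restrict (f \<circ> restrict (?g \<circ> \<phi>) VH) VH = \<phi>"
      proof
        fix v
        have "v \<in> VH \<Longrightarrow> \<phi> v \<in> f ` VH" using \<phi> imgf by auto
        then show "restrict (f \<circ> restrict (?g \<circ> \<phi>) VH) VH v = \<phi> v"
          using \<phi> by (cases "v \<in> VH") (auto simp: f_inv_into_f inj_maps_def PiE_iff extensional_def)
      qed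
    qed
    show "(\<lambda>\<pi>. restrict (f \<circ> \<pi>) VH) ` automorphisms VH EH \<subseteq> ?F"
    proof
      fix \<phi> assume "\<phi> \<in> (\<lambda>\<pi>. restrict (f \<circ> \<pi>) VH) ` automorphisms VH EH"
      then obtain \<pi> where \<pi>: "\<pi> \<in> VH \<rightarrow>\<^sub>E VH" "bij_betw \<pi> VH VH" "(`) \<pi> ` EH = EH"
        "\<phi> = restrict (f \<circ> \<pi>) VH" by (auto simp: automorphisms_def)
      have bij: "bij_betw \<phi> VH V'"
        using bij_betw_trans[OF \<pi>(2) f(1)] \<pi>(4) bij_betw_cong[of VH "restrict (f \<circ> \<pi>) VH" "f \<circ> \<pi>" V']
        by simp
      have E': "(`) \<phi> ` EH = E'" unfolding \<pi>(4) img \<pi>(3) f(2) ..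
      have "\<phi> \<in> VH \<rightarrow>\<^sub>E V" using bij sub(1) \<pi>(4) by (auto simp: bij_betw_def PiE_iff)
      then show "\<phi> \<in> ?F" using bij E' sub(2) by (auto simp: inj_maps_def bij_betw_def)
    qed
    show "(\<lambda>\<phi>. restrict (?g \<circ> \<phi>) VH) ` ?F \<subseteq> automorphisms VH EH"
    proof
      fix \<pi> assume "\<pi> \<in> (\<lambda>\<phi>. restrict (?g \<circ> \<phi>) VH) ` ?F"
      then obtain \<phi> where \<phi>: "\<phi> \<in> VH \<rightarrow>\<^sub>E V" "inj_on \<phi> VH" "\<phi> ` VH = V'" "(`) \<phi> ` EH = E'"
        "\<pi> = restrict (?g \<circ> \<phi>) VH" by (auto simp: inj_maps_def)
      have "bij_betw \<phi> VH V'" using \<phi> by (simp add: bij_betw_def)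
      then have bij: "bij_betw \<pi> VH VH"
        using bij_betw_trans[OF _ g] \<phi>(5) bij_betw_cong[of VH "restrict (?g \<circ> \<phi>) VH" "?g \<circ> \<phi>" VH]
        by auto
      have "(`) \<pi> ` EH = (`) ?g ` ((`) f ` EH)" unfolding \<phi>(5) img \<phi>(4) f(2) ..
      also have "\<dots> = ((`) ?g \<circ> (`) f) ` EH" by (simp only: image_comp)
      also have "\<dots> = id ` EH"
      proof (rule image_cong)
        fix e assume "e \<in> EH"
        then show "((`) ?g \<circ> (`) f) e = id e"
          using inv_into_image_cancel[OF injf, of e] EH by auto
      qed simp
      finally have "(`) \<pi> ` EH = EH" by simp
      then show "\<pi> \<in> automorphisms VH EH"
        using bij \<phi>(5) by (auto simp: automorphisms_def bij_betw_def PiE_iff)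
    qed
  qed
  then show ?thesis by (rule bij_betw_same_card[symmetric])
qed

lemma card_inj_maps:
  assumes "finite VH" "EH \<subseteq> Pow VH" "finite V" "E \<subseteq> Pow V"
  shows "card (inj_maps VH EH V E) = sub_count VH EH V E * card (automorphisms VH EH)"
proof -
  let ?g = "\<lambda>\<phi>. (\<phi> ` VH, (`) \<phi> ` EH)"
  have fin: "finite (inj_maps VH EH V E)"
    unfolding inj_maps_def using assms by (simp add: finite_PiE)
  have "?g ` inj_maps VH EH V E \<subseteq> copies VH EH V E"
    by (auto simp: inj_maps_def copies_def graph_iso_def bij_betw_def)
  then have "(\<Sum>p\<in>copies VH EH V E. \<Sum>\<phi>\<in>{\<phi> \<in> inj_maps VH EH V E. ?g \<phi> = p}. 1)
      = (\<Sum>\<phi>\<in>inj_maps VH EH V E. 1 :: nat)"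
    using fin finite_copies[OF assms(3,4)] by (intro sum.group) auto
  then have "card (inj_maps VH EH V E) = (\<Sum>p\<in>copies VH EH V E. card {\<phi> \<in> inj_maps VH EH V E. ?g \<phi> = p})"
    by simp
  also have "\<dots> = (\<Sum>p\<in>copies VH EH V E. card (automorphisms VH EH))"
    using card_inj_maps_onto_copy[OF assms(2)] by (intro sum.cong) auto
  finally show ?thesis by (simp add: sub_count_def copies_def)
qed

lemma rel_graph_edge_rel: "simple_graph V E \<Longrightarrow> rel_graph (edge_rel E)"
  unfolding rel_graph_def edge_rel_def
proof (intro conjI allI impI)
  fix x assume "simple_graph V E"
  then show "{x, x} \<notin> E" by (auto simp: simple_graph_def)
qed (simp add: insert_commute)

lemma simple_graph_edges_of: "finite V \<Longrightarrow> rel_graph A \<Longrightarrow> simple_graph V (edges_of V A)"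
proof -
  assume "finite V" "rel_graph A"
  moreover from this have "\<not> A x x" for x by (simp add: rel_graph_def)
  ultimately show ?thesis unfolding simple_graph_def edges_of_def by blast
qed

lemma edge_rel_edges_of:
  "rel_graph A \<Longrightarrow> x \<in> V \<Longrightarrow> y \<in> V \<Longrightarrow> edge_rel (edges_of V A) x y \<longleftrightarrow> A x y"
  unfolding rel_graph_def edge_rel_def edges_of_def mem_Collect_eq doubleton_eq_iff by metis

lemma clique_free_of_free:
  assumes "finite V" "simple_graph V E" "free {0..<Suc r} (complete_edges (Suc r)) V E"
  shows "clique_free r V (edge_rel E)"
  unfolding clique_free_def
proof (intro allI impI, rule ccontr)
  fix K assume K: "K \<subseteq> V" "\<forall>x\<in>K. \<forall>y\<in>K. x \<noteq> y \<longrightarrow> edge_rel E x y" and "\<not> card K \<le> r"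
  then have "Suc r \<le> card K" by simp
  then obtain K' where K': "K' \<subseteq> K" "card K' = Suc r" "finite K'"
    by (rule obtain_subset_with_card_n)
  obtain f where f: "bij_betw f {0..<Suc r} K'"
    using ex_bij_betw_nat_finite[OF K'(3)] K'(2) by auto
  let ?E = "(`) f ` complete_edges (Suc r)"
  have "?E \<subseteq> E"
  proof
    fix e assume "e \<in> ?E"
    then obtain u v where uv: "u < Suc r" "v < Suc r" "u \<noteq> v" "e = {f u, f v}"
      by (auto simp: complete_edges_def)
    then have "f u \<in> K" "f v \<in> K" "f u \<noteq> f v"
      using f K'(1) by (auto simp: bij_betw_def inj_on_def)
    then show "e \<in> E" using K(2) uv(4) by (simp add: edge_rel_def)
  qed
  then have "(K', ?E) \<in> copies {0..<Suc r} (complete_edges (Suc r)) V E"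
    using f K K' by (auto simp: copies_def graph_iso_def)
  \<comment> \<open>Finiteness is essential here: an infinite family would have cardinality 0 and
    pass for \<open>free\<close>.\<close>
  then have "card (copies {0..<Suc r} (complete_edges (Suc r)) V E) \<noteq> 0"
    using finite_copies[OF assms(1) simple_graph_subset_Pow[OF assms(2)]] card_0_eq by blast
  then show False using assms(3) by (simp add: free_def sub_count_def copies_def)
qed

lemma free_edges_of:
  assumes "rel_graph A" "clique_free r V A"
  shows "free {0..<Suc r} (complete_edges (Suc r)) V (edges_of V A)"
proof -
  have "copies {0..<Suc r} (complete_edges (Suc r)) V (edges_of V A) = {}"
  proof (rule ccontr)
    assume "\<not> ?thesis"
    then obtain V' f where V': "V' \<subseteq> V" and f: "bij_betw f {0..<Suc r} V'"
      and E': "(`) f ` complete_edges (Suc r) \<subseteq> edges_of V A"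
      by (auto simp: copies_def graph_iso_def)
    have "A x y" if xy: "x \<in> V'" "y \<in> V'" "x \<noteq> y" for x y
    proof -
      obtain i j where ij: "i < Suc r" "j < Suc r" "x = f i" "y = f j"
        using f xy(1,2) unfolding bij_betw_def by (metis atLeastLessThan_iff imageE)
      then have "{i, j} \<in> complete_edges (Suc r)" using xy(3) by (auto simp: complete_edges_def)
      then have "f ` {i, j} \<in> edges_of V A" using E' by blast
      then have "edge_rel (edges_of V A) x y" using ij by (simp add: edge_rel_def)
      then show ?thesis using edge_rel_edges_of[OF assms(1), of x V y] V' xy by blast
    qed
    then have "card V' \<le> r" using assms(2) V' by (simp add: clique_free_def)
    moreover have "card V' = Suc r" using bij_betw_same_card[OF f] by simp
    ultimately show False by simp
  qed
  then show ?thesis unfolding free_def sub_count_def copies_def[symmetric] by simp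
qed

lemma sub_count_le_gen_ex:
  assumes "simple_graph {0..<n} E" "free VF EF {0..<n} E"
  shows "sub_count VH EH {0..<n} E \<le> gen_ex n VH EH VF EF"
  unfolding gen_ex_def
proof (rule Max_ge)
  have "{sub_count VH EH {0..<n} E | E. simple_graph {0..<n} E \<and> free VF EF {0..<n} E}
      \<subseteq> sub_count VH EH {0..<n} ` Pow (Pow {0..<n})"
    using simple_graph_subset_Pow by blast
  then show "finite {sub_count VH EH {0..<n} E | E. simple_graph {0..<n} E \<and> free VF EF {0..<n} E}"
    by (rule finite_subset) simp
qed (use assms in blast)

text \<open>The identity is one of the relabellings in the minimum. The crude bound by
  \<open>card (Pow {0..<n})\<close> only secures the finiteness that \<open>Min\<close>
  requires.\<close>

lemma edit_dist_le:
  assumes "E \<subseteq> Pow {0..<n}" "T \<subseteq> Pow {0..<n}"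
  shows "edit_dist n E T \<le> card ((E - T) \<union> (T - E))"
  unfolding edit_dist_def
proof (rule Min_le)
  let ?D = "\<lambda>f. (E - (`) f ` T) \<union> ((`) f ` T - E)"
  have "card (?D f) \<le> card (Pow {0..<n})" if "bij_betw f {0..<n} {0..<n}" for f
  proof (rule card_mono)
    have "f ` {0..<n} = {0..<n}" using that by (simp add: bij_betw_def)
    then have "(`) f ` T \<subseteq> Pow {0..<n}" using assms(2) by blast
    then show "?D f \<subseteq> Pow {0..<n}" using assms(1) by blast
  qed simp
  then have "{card (?D f) | f. bij_betw f {0..<n} {0..<n}} \<subseteq> {..card (Pow {0..<n})}" by blast
  then show "finite {card (?D f) | f. bij_betw f {0..<n} {0..<n}}"
    by (rule finite_subset) simp
  have "card ((E - T) \<union> (T - E)) = card (?D id)" by simp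
  then show "card ((E - T) \<union> (T - E)) \<in> {card (?D f) | f. bij_betw f {0..<n} {0..<n}}"
    using bij_betw_id by blast
qed

text \<open>Forgetting the order turns the error pairs into a set containing every edge to be
  edited; the factor 2 lost is harmless.\<close>

lemma edit_dist_colouring_le:
  assumes E: "simple_graph {0..<n} E"
  shows "edit_dist n E {{u, v} | u v. u \<in> {0..<n} \<and> v \<in> {0..<n} \<and> c u \<noteq> c v}
    \<le> card (colour_errors {0..<n} (edge_rel E) c)"
proof -
  let ?T = "{{u, v} | u v. u \<in> {0..<n} \<and> v \<in> {0..<n} \<and> c u \<noteq> c v}"
  let ?err = "colour_errors {0..<n} (edge_rel E) c"
  have "edit_dist n E ?T \<le> card ((E - ?T) \<union> (?T - E))"
    using simple_graph_subset_Pow[OF E] by (intro edit_dist_le) auto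
  also have "\<dots> \<le> card ((\<lambda>(u, v). {u, v}) ` ?err)"
  proof (rule card_mono)
    show "finite ((\<lambda>(u, v). {u, v}) ` ?err)" by (simp add: finite_colour_errors)
    show "(E - ?T) \<union> (?T - E) \<subseteq> (\<lambda>(u, v). {u, v}) ` ?err"
    proof
      fix e assume e: "e \<in> (E - ?T) \<union> (?T - E)"
      have "\<exists>u v. u \<in> {0..<n} \<and> v \<in> {0..<n} \<and> e = {u, v}"
        using e E unfolding simple_graph_def by blast
      then obtain u v where uv: "u \<in> {0..<n}" "v \<in> {0..<n}" "e = {u, v}" by blast
      have "e \<in> ?T \<longleftrightarrow> c u \<noteq> c v" unfolding uv(3) using uv(1,2) by (auto simp: doubleton_eq_iff)
      then have "(u, v) \<in> ?err" using e uv by (auto simp: colour_errors_def edge_rel_def)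
      then show "e \<in> (\<lambda>(u, v). {u, v}) ` ?err" using uv(3) by force
    qed
  qed
  also have "\<dots> \<le> card ?err" by (rule card_image_le) (simp add: finite_colour_errors)
  finally show ?thesis .
qed

section \<open>Near-extremal graphs as near-optimal relations\<close>

context multipartite_pattern
begin

definition EH :: "'a set set" where
  "EH = {{u, v} | u v. u \<in> VH \<and> v \<in> VH \<and> cH u \<noteq> cH v}"

lemma EH_subset: "EH \<subseteq> Pow VH"
  by (auto simp: EH_def)

lemma inj_maps_eq_homs: "inj_maps VH EH V E = {\<phi> \<in> homs V (edge_rel E). inj_on \<phi> VH}"
proof -
  have "(\<forall>e\<in>EH. \<phi> ` e \<in> E) \<longleftrightarrow> ishom (edge_rel E) \<phi>" for \<phi> :: "'a \<Rightarrow> 'b"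
  proof
    assume *: "\<forall>e\<in>EH. \<phi> ` e \<in> E"
    show "ishom (edge_rel E) \<phi>"
      unfolding ishom_def edge_rel_def
    proof (intro ballI impI)
      fix u v assume "u \<in> VH" "v \<in> VH" "cH u \<noteq> cH v"
      then have "{u, v} \<in> EH" by (auto simp: EH_def)
      then have "\<phi> ` {u, v} \<in> E" using * by blast
      then show "{\<phi> u, \<phi> v} \<in> E" by simp
    qed
  next
    assume *: "ishom (edge_rel E) \<phi>"
    show "\<forall>e\<in>EH. \<phi> ` e \<in> E"
    proof
      fix e assume "e \<in> EH"
      then obtain u v where "u \<in> VH" "v \<in> VH" "cH u \<noteq> cH v" "e = {u, v}" by (auto simp: EH_def)
      then show "\<phi> ` e \<in> E" using * by (simp add: ishom_def edge_rel_def)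
    qed
  qed
  then show ?thesis by (auto simp: inj_maps_def homs_def)
qed

lemma homs_edges_of: "rel_graph A \<Longrightarrow> homs V (edge_rel (edges_of V A)) = homs V A"
proof -
  assume A: "rel_graph A"
  have "ishom (edge_rel (edges_of V A)) \<phi> \<longleftrightarrow> ishom A \<phi>" if "\<phi> \<in> VH \<rightarrow>\<^sub>E V" for \<phi>
    unfolding ishom_def using edge_rel_edges_of[OF A PiE_mem[OF that] PiE_mem[OF that]] by simp
  then show ?thesis by (auto simp: homs_def)
qed

text \<open>Copies times automorphisms are the injective homomorphisms, so the two counts differ
  only by non-injective maps, which are of lower order.\<close>

lemma card_homs_sub_count:
  assumes "finite V" "E \<subseteq> Pow V"
  shows "sub_count VH EH V E * card (automorphisms VH EH) \<le> card (homs V (edge_rel E))"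
    and "card (homs V (edge_rel E))
      \<le> sub_count VH EH V E * card (automorphisms VH EH) + (card VH)\<^sup>2 * card V ^ (card VH - 1)"
proof -
  let ?I = "{\<phi> \<in> homs V (edge_rel E). inj_on \<phi> VH}"
  let ?N = "{\<phi> \<in> VH \<rightarrow>\<^sub>E V. \<not> inj_on \<phi> VH}"
  have I: "card ?I = sub_count VH EH V E * card (automorphisms VH EH)"
    using card_inj_maps[OF finVH EH_subset assms] by (simp add: inj_maps_eq_homs)
  show "sub_count VH EH V E * card (automorphisms VH EH) \<le> card (homs V (edge_rel E))"
    unfolding I[symmetric] using finite_homs[OF assms(1)] by (intro card_mono) auto
  have "card (homs V (edge_rel E)) \<le> card (?I \<union> ?N)"
    using finite_homs[OF assms(1)] finite_maps[OF assms(1)]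
    by (intro card_mono) (auto simp: homs_def)
  also have "\<dots> \<le> card ?I + card ?N" by (rule card_Un_le)
  also have "\<dots> \<le> card ?I + (card VH)\<^sup>2 * card V ^ (card VH - 1)"
    using card_PiE_not_inj[OF finVH assms(1) card_VH_ge2] by simp
  finally show "card (homs V (edge_rel E))
      \<le> sub_count VH EH V E * card (automorphisms VH EH) + (card VH)\<^sup>2 * card V ^ (card VH - 1)"
    unfolding I .
qed

text \<open>On \<open>{0..<n}\<close> a competing relation is the edge relation of a simple graph
  without a clique on \<open>r + 1\<close> vertices, so \<open>gen_ex\<close> bounds its copies.
  Converting copies to homomorphisms multiplies the slack by the number of automorphisms and adds
  the non-injective maps of the competitor.\<close>

lemma near_opt_of_gen_ex:
  fixes \<delta> :: real
  assumes E: "simple_graph {0..<n} E" "free {0..<Suc r} (complete_edges (Suc r)) {0..<n} E"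
    and near: "real (gen_ex n VH EH {0..<Suc r} (complete_edges (Suc r))) - \<delta> * real n ^ card VH
      \<le> real (sub_count VH EH {0..<n} E)"
  shows "near_opt r {0..<n} (edge_rel E)
    (real (card (automorphisms VH EH)) * \<delta> * real n ^ card VH + real (card VH) ^ 2 * real n ^ (card VH - 1))"
  unfolding near_opt_def
proof (intro conjI allI impI)
  show "rel_graph (edge_rel E)" using E(1) by (rule rel_graph_edge_rel)
  show "clique_free r {0..<n} (edge_rel E)" using E by (intro clique_free_of_free) auto
  fix A :: "nat \<Rightarrow> nat \<Rightarrow> bool"
  assume A: "rel_graph A \<and> clique_free r {0..<n} A"
  let ?a = "card (automorphisms VH EH)"
  let ?F = "edges_of {0..<n} A"
  let ?g = "gen_ex n VH EH {0..<Suc r} (complete_edges (Suc r))"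
  have F: "simple_graph {0..<n} ?F" using A by (intro simple_graph_edges_of) auto
  have "sub_count VH EH {0..<n} ?F \<le> ?g"
    using A free_edges_of by (intro sub_count_le_gen_ex F) auto
  then have "sub_count VH EH {0..<n} ?F * ?a \<le> ?g * ?a" by (rule mult_right_mono) simp
  moreover have "card (homs {0..<n} A)
      \<le> sub_count VH EH {0..<n} ?F * ?a + (card VH)\<^sup>2 * n ^ (card VH - 1)"
    using card_homs_sub_count(2)[OF finite_atLeastLessThan simple_graph_subset_Pow[OF F]] A
    by (simp add: homs_edges_of)
  ultimately have "card (homs {0..<n} A) \<le> ?g * ?a + (card VH)\<^sup>2 * n ^ (card VH - 1)"
    by linarith
  then have "real (card (homs {0..<n} A)) \<le> real (?g * ?a + (card VH)\<^sup>2 * n ^ (card VH - 1))"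
    by (simp only: of_nat_le_iff)
  then have 1: "real (card (homs {0..<n} A)) \<le> real ?g * real ?a + real (card VH) ^ 2 * real n ^ (card VH - 1)"
    by simp
  have "real ?g * real ?a \<le> (real (sub_count VH EH {0..<n} E) + \<delta> * real n ^ card VH) * real ?a"
    using near by (intro mult_right_mono) auto
  also have "\<dots> = real (sub_count VH EH {0..<n} E * ?a) + real ?a * \<delta> * real n ^ card VH"
    by (simp add: distrib_right)
  also have "sub_count VH EH {0..<n} E * ?a \<le> card (homs {0..<n} (edge_rel E))"
    by (rule card_homs_sub_count(1)[OF _ simple_graph_subset_Pow[OF E(1)]]) simp
  then have "real (sub_count VH EH {0..<n} E * ?a) \<le> real (card (homs {0..<n} (edge_rel E)))"
    by (simp only: of_nat_le_iff)
  finally show "real (card (homs {0..<n} A)) \<le> real (card (homs {0..<n} (edge_rel E)))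
    + (real ?a * \<delta> * real n ^ card VH + real (card VH) ^ 2 * real n ^ (card VH - 1))"
    using 1 by linarith
qed

end

theorem theorem1p1:
  fixes k r :: nat and VH :: "'a set" and EH :: "'a set set"
  assumes "2 \<le> k" and "k \<le> r"
    and "finite VH" and "complete_multipartite k VH EH"
  shows "\<forall>\<epsilon>::real. \<epsilon> > 0 \<longrightarrow>
    (\<exists>\<delta>::real. \<delta> > 0 \<and> (\<exists>n0::nat. \<forall>n\<ge>n0. \<forall>E :: nat set set.
       simple_graph {0..<n} E \<and> free {0..<Suc r} (complete_edges (Suc r)) {0..<n} E \<and>
       real (sub_count VH EH {0..<n} E)
         \<ge> real (gen_ex n VH EH {0..<Suc r} (complete_edges (Suc r))) - \<delta> * real n ^ card VH
       \<longrightarrow> (\<exists>T :: nat set set. complete_multipartite r {0..<n} T \<and>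
              real (edit_dist n E T) \<le> \<epsilon> * real n ^ 2)))"
proof (intro allI impI)
  fix \<epsilon> :: real assume \<epsilon>: "\<epsilon> > 0"
  obtain cH where cH: "cH ` VH = {0..<k}" "EH = {{u, v} | u v. u \<in> VH \<and> v \<in> VH \<and> cH u \<noteq> cH v}"
    using assms(4) by (auto simp: complete_multipartite_def)
  interpret P: multipartite_pattern VH cH k
    by unfold_locales (use assms cH in auto)
  have EH: "EH = P.EH" by (simp add: cH(2) P.EH_def)
  obtain d n1 where d: "0 < d" and close: "\<forall>(V :: nat set) A. finite V \<and> n1 \<le> card V
      \<and> P.near_opt r V A (d * real (card V) ^ card VH)
      \<longrightarrow> (\<exists>c. c ` V = {0..<r} \<and> real (card (colour_errors V A c)) \<le> \<epsilon> * real (card V) ^ 2)"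
    using P.near_opt_close_to_colouring[OF assms(2) \<epsilon>] by (elim exE conjE)
  define a where "a = real (card (automorphisms VH EH))"
  define h where "h = real (card VH)"
  \<comment> \<open>The conversion to homomorphisms multiplies the slack by \<open>a\<close>, and
    \<open>a * \<delta>\<close> may use up half of \<open>d\<close>. With \<open>a + 1\<close> the
    quotient makes sense without showing that \<open>a\<close> is nonzero.\<close>
  define \<delta> where "\<delta> = d / (2 * (a + 1))"
  have a: "0 \<le> a" by (simp add: a_def)
  have \<delta>: "\<delta> > 0" using d a by (simp add: \<delta>_def)
  have a\<delta>: "a * \<delta> \<le> d / 2" using d a by (simp add: \<delta>_def field_simps)
  \<comment> \<open>From here on the non-injective maps fit into the other half of \<open>d\<close>:
    h^2 n^(h - 1) \<le> d / 2 * n^h.\<close>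
  define n0 where "n0 = n1 + nat \<lceil>2 * h\<^sup>2 / d\<rceil> + 1"
  have main: "\<exists>T. complete_multipartite r {0..<n} T \<and> real (edit_dist n E T) \<le> \<epsilon> * real n ^ 2"
    if n: "n \<ge> n0" and E: "simple_graph {0..<n} E" "free {0..<Suc r} (complete_edges (Suc r)) {0..<n} E"
      and near: "real (sub_count VH EH {0..<n} E)
         \<ge> real (gen_ex n VH EH {0..<Suc r} (complete_edges (Suc r))) - \<delta> * real n ^ card VH" for n E
  proof -
    have "2 * h\<^sup>2 / d \<le> real n" using n unfolding n0_def by linarith
    then have "h\<^sup>2 \<le> d / 2 * real n" using d by (simp add: field_simps)
    then have "h\<^sup>2 * real n ^ (card VH - 1) \<le> d / 2 * real n * real n ^ (card VH - 1)"
      by (intro mult_right_mono) auto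
    also have "\<dots> = d / 2 * (real n * real n ^ (card VH - 1))" by simp
    also have "real n * real n ^ (card VH - 1) = real n ^ card VH"
      using P.card_VH_ge2 by (metis Suc_diff_1 less_le_trans pos2 power_Suc)
    finally have "h\<^sup>2 * real n ^ (card VH - 1) \<le> d / 2 * real n ^ card VH" .
    moreover have "a * \<delta> * real n ^ card VH \<le> d / 2 * real n ^ card VH"
      using a\<delta> by (intro mult_right_mono) auto
    ultimately have "a * \<delta> * real n ^ card VH + h\<^sup>2 * real n ^ (card VH - 1) \<le> d * real n ^ card VH"
      by linarith
    then have "P.near_opt r {0..<n} (edge_rel E) (d * real n ^ card VH)"
      using P.near_opt_mono[OF P.near_opt_of_gen_ex[OF E near[unfolded EH]]]
      by (simp add: a_def h_def EH)
    then obtain c where c: "c ` {0..<n} = {0..<r}"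
      "real (card (colour_errors {0..<n} (edge_rel E) c)) \<le> \<epsilon> * real n ^ 2"
      using close[rule_format, of "{0..<n}" "edge_rel E"] n by (auto simp: n0_def)
    let ?T = "{{u, v} | u v. u \<in> {0..<n} \<and> v \<in> {0..<n} \<and> c u \<noteq> c v}"
    have "complete_multipartite r {0..<n} ?T"
      unfolding complete_multipartite_def using c(1) by blast
    moreover have "real (edit_dist n E ?T) \<le> \<epsilon> * real n ^ 2"
      using edit_dist_colouring_le[OF E(1), of c] c(2) by linarith
    ultimately show ?thesis by blast
  qed
  show "\<exists>\<delta>>0. \<exists>n0. \<forall>n\<ge>n0. \<forall>E :: nat set set.
       simple_graph {0..<n} E \<and> free {0..<Suc r} (complete_edges (Suc r)) {0..<n} E \<and>
       real (sub_count VH EH {0..<n} E)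
         \<ge> real (gen_ex n VH EH {0..<Suc r} (complete_edges (Suc r))) - \<delta> * real n ^ card VH
       \<longrightarrow> (\<exists>T :: nat set set. complete_multipartite r {0..<n} T \<and>
              real (edit_dist n E T) \<le> \<epsilon> * real n ^ 2)"
    by (rule exI[of _ \<delta>], rule conjI[OF \<delta>], rule exI[of _ n0]) (use main in blast)
qed

end
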